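(* Let $p\in(0,1]$ and let $\check S$ be the random walk with counterbalanced steps with innovation parameter $p$ and step law $\mu$. If $X_1\in L^2(\mathbb{P})$, with $m_1=\mathbb{E}(X_1)$ and $m_2=\mathbb{E}(X_1^2)$, then as $n\to\infty$ there is the convergence in distribution $$\frac{\check S(n)-\frac{p}{2-p}m_1 n}{\sqrt n}\ \longrightarrow\ \mathcal{N}\left(0,\ \frac{m_2-\left(\frac{p}{2-p}m_1\right)^2}{3-2p}\right),$$ where the right-hand side denotes a centered Gaussian variable parametrized by mean and variance.
   Context: Let $\mu$ be a probability law on $\mathbb{R}$ and $p\in[0,1]$. Let $(X_n)_{n\ge1}$ be i.i.d. real random variables with law $\mu$; let $(\varepsilon_n)_{n\ge2}$ be i.i.d. Bernoulli variables with $\mathbb{P}(\varepsilon_n=1)=p$, $\mathbb{P}(\varepsilon_n=0)=1-p$, and set $\varepsilon_1=1$; let $(v(n))_{n\ge2}$ be independent random variables with $v(n)$ uniform on $\{1,\dots,n-1\}$. The three sequences $(X_n)$, $(\varepsilon_n)$, $(v(n))$ are independent of each other. Put $\mathrm{i}(n)=\sum_{j=1}^n\varepsilon_j$ for $n\ge1$. The counterbalanced sequence $(\check X_n)_{n\ge1}$ is defined recursively by $\check X_n=X_{\mathrm{i}(n)}$ if $\varepsilon_n=1$ (in particular $\check X_1=X_1$), and $\check X_n=-\check X_{v(n)}$ if $\varepsilon_n=0$. The random walk with counterbalanced steps is $\check S(n)=\check X_1+\cdots+\check X_n$, $n\ge0$. *)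

theory Defs
  imports "HOL-Probability.Probability"
begin

definition innov_count :: "(nat \<Rightarrow> 'a \<Rightarrow> nat) \<Rightarrow> nat \<Rightarrow> 'a \<Rightarrow> nat" where
  "innov_count eps n \<omega> = (\<Sum>j = 1..n. eps j \<omega>)"

text \<open>The guard on \<open>v n \<omega>\<close> makes the recursion terminate for every outcome. When
  \<open>v n\<close> is uniform on \<open>{1..<n}\<close> it holds almost surely, so the value 0 is taken
  only on a null set.\<close>

fun cb_step ::
  "(nat \<Rightarrow> 'a \<Rightarrow> real) \<Rightarrow> (nat \<Rightarrow> 'a \<Rightarrow> nat) \<Rightarrow> (nat \<Rightarrow> 'a \<Rightarrow> nat) \<Rightarrow> nat \<Rightarrow> 'a \<Rightarrow> real" where
  "cb_step X eps v n \<omega> =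
     (if eps n \<omega> = 1 then X (innov_count eps n \<omega>) \<omega>
      else if 1 \<le> v n \<omega> \<and> v n \<omega> < n then - cb_step X eps v (v n \<omega>) \<omega>
      else 0)"

declare cb_step.simps [simp del]

definition cb_walk ::
  "(nat \<Rightarrow> 'a \<Rightarrow> real) \<Rightarrow> (nat \<Rightarrow> 'a \<Rightarrow> nat) \<Rightarrow> (nat \<Rightarrow> 'a \<Rightarrow> nat) \<Rightarrow> nat \<Rightarrow> 'a \<Rightarrow> real" where
  "cb_walk X eps v n \<omega> = (\<Sum>k = 1..n. cb_step X eps v k \<omega>)"

definition sigma_of_family ::
  "'a measure \<Rightarrow> 'b measure \<Rightarrow> ('i \<Rightarrow> 'a \<Rightarrow> 'b) \<Rightarrow> 'i set \<Rightarrow> 'a set set" where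
  "sigma_of_family M N Y I =
     sigma_sets (space M) (\<Union>i\<in>I. {Y i -` A \<inter> space M | A. A \<in> sets N})"

text \<open>The three sequences take values in different types, so their mutual independence
  is stated through the sigma-algebras they generate. Measurability of the individual
  variables is part of \<^const>\<open>prob_space.indep_vars\<close>.\<close>

locale counterbalanced = prob_space M
  for M :: "'a measure" +
  fixes \<mu> :: "real measure" and p :: real
    and X :: "nat \<Rightarrow> 'a \<Rightarrow> real" and eps v :: "nat \<Rightarrow> 'a \<Rightarrow> nat"
  assumes law: "real_distribution \<mu>"
    and p: "p \<in> {0..1}"
    and X_indep: "indep_vars (\<lambda>_. borel) X {1..}"
    and X_law: "\<And>n. n \<ge> 1 \<Longrightarrow> distr M borel (X n) = \<mu>"
    and eps_1: "\<And>\<omega>. \<omega> \<in> space M \<Longrightarrow> eps 1 \<omega> = 1"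
    and eps_indep: "indep_vars (\<lambda>_. count_space UNIV) eps {2..}"
    and eps_law_1: "\<And>n. n \<ge> 2 \<Longrightarrow> prob {\<omega> \<in> space M. eps n \<omega> = 1} = p"
    and eps_law_0: "\<And>n. n \<ge> 2 \<Longrightarrow> prob {\<omega> \<in> space M. eps n \<omega> = 0} = 1 - p"
    and v_indep: "indep_vars (\<lambda>_. count_space UNIV) v {2..}"
    and v_law: "\<And>n. n \<ge> 2 \<Longrightarrow>
        distr M (count_space UNIV) (v n) = measure_pmf (pmf_of_set {1..n - 1})"
    and seqs_indep: "indep_sets
        (\<lambda>k. [sigma_of_family M borel X {1..},
              sigma_of_family M (count_space UNIV) eps {2..},
              sigma_of_family M (count_space UNIV) v {2..}] ! k) {..<3}"

text \<open>Parametrized by mean and variance; variance 0 gives the point mass, which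
  \<^const>\<open>normal_density\<close> does not cover.\<close>

definition gaussian :: "real \<Rightarrow> real \<Rightarrow> real measure" where
  "gaussian m s2 =
     (if s2 = 0 then return borel m else density lborel (normal_density m (sqrt s2)))"

end

(*
  With q = 1 - p and c = p m1 / (2 - p), the centred walk Y k = S k - c k satisfies
  E [Y (k + 1) | past] = (1 - q / k) Y k, and the conditional second moment of the increment
  converges in L1 to sigma^2 = m2 - c^2, by a weak law of large numbers for the squared steps
  (proved by truncation and a second moment recursion). A second order Taylor expansion therefore
  gives, for the characteristic functions phi k of Y k,

    phi (k + 1) t = phi k ((1 - q / k) t) (1 - t^2 sigma^2 / 2) + t^2 o(1),

  a recursion which exp (- t^2 k sigma^2 / (2 (3 - 2 p))) satisfies up to an error of the same
  kind. In n steps, with t of order 1 / sqrt n, the errors add up to a Cesaro mean of o(1), and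
  Levy's continuity theorem applies.
*)

theory Submission
  imports Defs
begin

section \<open>Analytic preliminaries\<close>

text \<open>Taken literally, the drift \<open>- (1 - p) / k * Y k\<close> puts a derivative of the
  characteristic function into the recursion. To first order it amounts to a change of frequency,
  which is why \<open>\<phi> k\<close> is evaluated at a contracted argument; the second order error
  has size \<open>t\<^sup>2 / k\<close> because the second moment of \<open>Y k\<close> grows at
  most linearly. Contraction keeps the argument in \<open>[-T, T]\<close>, and for
  \<open>T\<^sup>2 * sg2 \<le> 2\<close> the multiplier stays in \<open>[0, 1]\<close>, so errors
  are added and never amplified. Conditioning on the past is expressed by integrating against
  functions of a sum over past steps. The obstacle is that an innovation uses the variable with the
  random index \<open>innov k + 1\<close>, which is independent of the past only after splitting by
  the value of \<open>innov k\<close>. The squared steps behave unlike the walk itself: signs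
  disappear, so copies reinforce fluctuations, and two moments of \<open>X 1\<close> give the
  squares no variance. Truncation cures the second defect, and \<open>0 < p\<close> the first, since
  it makes the variance of order \<open>k powr (2 - p)\<close> negligible against
  \<open>k\<^sup>2\<close>.\<close>

lemma cesaro_null:
  fixes a :: "nat \<Rightarrow> real"
  assumes "a \<longlonglongrightarrow> 0"
  shows "(\<lambda>n. (\<Sum>j=1..<n. a j) / n) \<longlonglongrightarrow> 0"
proof (rule LIMSEQ_I)
  fix e :: real assume e: "0 < e"
  obtain N where N: "\<And>j. N \<le> j \<Longrightarrow> \<bar>a j\<bar> < e / 2"
    using LIMSEQ_D[OF assms, of "e / 2"] e by auto
  define B where "B = (\<Sum>j=1..<N. \<bar>a j\<bar>)"
  \<comment> \<open>Beyond \<open>N'\<close> the fixed initial block \<open>B\<close> contributes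
    less than half of \<open>n * e\<close>; the remaining terms are below \<open>e / 2\<close>
    each.\<close>
  obtain N' :: nat where N': "2 * B / e < N'" using reals_Archimedean2 by blast
  show "\<exists>no. \<forall>n\<ge>no. norm ((\<Sum>j=1..<n. a j) / n - 0) < e"
  proof (intro exI allI impI)
    fix n assume n: "max 1 (max N N') \<le> n"
    have "\<bar>\<Sum>j=1..<n. a j\<bar> \<le> (\<Sum>j=1..<n. \<bar>a j\<bar>)" by (rule sum_abs)
    also have "\<dots> \<le> (\<Sum>j=1..<n. (if j < N then \<bar>a j\<bar> else 0) + e / 2)"
      using N e by (intro sum_mono) (auto simp: not_less less_imp_le)
    also have "\<dots> = (\<Sum>j=1..<n. if j < N then \<bar>a j\<bar> else 0) + (real n - 1) * (e / 2)"
      using n by (simp add: sum.distrib of_nat_diff)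
    also have "(\<Sum>j=1..<n. if j < N then \<bar>a j\<bar> else 0) = B"
      using n unfolding B_def by (intro sum.mono_neutral_cong_right) auto
    also have "B + (real n - 1) * (e / 2) < n * e"
    proof -
      have "2 * B < e * n" proof -
        have "2 * B < e * N'" using N' e by (simp add: field_simps)
        also have "e * N' \<le> e * n" using n e by (intro mult_left_mono) auto
        finally show ?thesis .
      qed
      moreover define y where "y = B + (real n - 1) * (e / 2)"
      moreover have "2 * y = 2 * B + e * n - e" unfolding y_def by (simp add: field_simps)
      ultimately have "y < e * n" using e by linarith
      then show ?thesis unfolding y_def by (simp add: mult.commute)
    qed
    finally show "norm ((\<Sum>j=1..<n. a j) / n - 0) < e"
      using n by (simp add: field_simps)
  qed
qed

lemma gaussian_real_distribution: "0 \<le> s2 \<Longrightarrow> real_distribution (gaussian m s2)"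
  using prob_space_normal_density[of "sqrt s2" m]
  by (auto simp: gaussian_def real_distribution_def real_distribution_axioms_def
      intro!: prob_space_return)

text \<open>For positive variance, dividing by the standard deviation gives the standard normal law,
  at the cost of scaling the frequency. Variance 0 is the point mass.\<close>

lemma char_gaussian:
  assumes "0 \<le> s2"
  shows "char (gaussian 0 s2) t = exp (- (t\<^sup>2 * s2) / 2)"
proof (cases "s2 = 0")
  case True
  then show ?thesis by (simp add: gaussian_def char_def integral_return)
next
  case False
  define \<sigma> where "\<sigma> = sqrt s2"
  have \<sigma>: "0 < \<sigma>" "\<sigma>\<^sup>2 = s2" using False assms by (auto simp: \<sigma>_def)
  let ?N = "density lborel (normal_density 0 \<sigma>)"
  interpret N: prob_space ?N using \<sigma> by (rule_tac prob_space_normal_density)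
  have "distributed ?N lborel (\<lambda>x. x) (normal_density 0 \<sigma>)"
    by (auto simp: distributed_def distr_id2)
  then have "distributed ?N lborel (\<lambda>x. (x - 0) / \<sigma>) std_normal_density"
    using N.normal_standard_normal_convert[OF \<sigma>(1)] by simp
  then have "distr ?N lborel (\<lambda>x. x / \<sigma>) = std_normal_distribution"
    by (simp add: distributed_def)
  then have "char std_normal_distribution (t * \<sigma>) = (CLINT x|distr ?N lborel (\<lambda>x. x / \<sigma>). iexp (t * \<sigma> * x))"
    by (simp add: char_def)
  also have "\<dots> = (CLINT x|?N. iexp (t * \<sigma> * (x / \<sigma>)))"
    by (rule integral_distr) simp_all
  also have "\<dots> = char ?N t"
    using \<sigma> by (simp add: char_def)
  finally show ?thesis
    using False \<sigma> by (simp add: gaussian_def char_std_normal_distribution \<sigma>_def[symmetric] power_mult_distrib)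
qed

lemma iexp_minus_1_le: "cmod (iexp x - 1) \<le> \<bar>x\<bar>"
  using iexp_approx1[of x 0] by simp

lemma iexp_first_order: "cmod (iexp x - 1 - \<i> * x) \<le> x\<^sup>2 / 2"
  using iexp_approx1[of x 1] by (simp add: power2_eq_square numeral_2_eq_2 diff_diff_eq)

text \<open>The cubic bound makes the remainder small for small arguments, the quadratic one keeps
  it integrable when only two moments exist. Both branches of the \<open>min\<close> are needed in
  the dominated convergence argument for \<open>rho\<close>.\<close>

lemma iexp_second_order:
  "cmod (iexp x - 1 - \<i> * x + of_real (x\<^sup>2) / 2) \<le> min (x\<^sup>2) (\<bar>x\<bar> ^ 3)"
proof -
  have eq: "(\<Sum>k\<le>2. (\<i> * x)^k / fact k) = 1 + \<i> * x - of_real (x\<^sup>2) / 2"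
    by (simp add: numeral_2_eq_2 power2_eq_square algebra_simps)
  have "cmod (iexp x - (\<Sum>k\<le>2. (\<i> * x)^k / fact k)) \<le> \<bar>x\<bar> ^ 3 / 6"
    using iexp_approx1[of x 2] by (simp add: eval_nat_numeral)
  also have "\<dots> \<le> \<bar>x\<bar> ^ 3" by simp
  finally have "cmod (iexp x - (\<Sum>k\<le>2. (\<i> * x)^k / fact k)) \<le> \<bar>x\<bar> ^ 3" .
  moreover have "cmod (iexp x - (\<Sum>k\<le>2. (\<i> * x)^k / fact k)) \<le> x\<^sup>2"
    using iexp_approx2[of x 2] by (simp add: fact_2)
  ultimately show ?thesis unfolding eq by (simp add: algebra_simps)
qed

lemma exp_minus_first_order:
  fixes u :: real
  assumes "0 \<le> u"
  shows "\<bar>exp (- u) - 1 + u\<bar> \<le> u\<^sup>2"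
proof -
  have "exp (- u) \<le> 1 / (1 + u)"
    using assms exp_ge_add_one_self[of u] by (simp add: exp_minus field_simps)
  also have "\<dots> \<le> 1 - u + u\<^sup>2"
    using assms by (simp add: field_simps power2_eq_square)
  finally show ?thesis using exp_ge_add_one_self[of "- u"] by simp
qed

text \<open>Mean value theorem: for \<open>r \<ge> 1\<close> the derivative is increasing, so its
  value at the left end bounds the increment from below. It closes inductions that carry a bound of
  order \<open>k powr r\<close>.\<close>

lemma powr_Suc_ge:
  assumes "1 \<le> r" "1 \<le> k"
  shows "real k powr r + r * real k powr (r - 1) \<le> real (Suc k) powr r"
proof -
  have "\<exists>z>real k. z < real k + 1 \<and>
      (real k + 1) powr r - real k powr r = (real k + 1 - real k) * (r * z powr (r - 1))"
    using assms by (intro MVT2 has_real_derivative_powr) auto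
  then obtain z where z: "real k < z"
    and eq: "(real k + 1) powr r - real k powr r = r * z powr (r - 1)" by auto
  have "r * real k powr (r - 1) \<le> r * z powr (r - 1)"
    using assms z by (intro mult_left_mono powr_mono2) auto
  then show ?thesis using eq by (simp add: add.commute)
qed

section \<open>Square-integrable functions on a probability space\<close>

context prob_space
begin

lemma integrable_mult_squares:
  fixes f g :: "'a \<Rightarrow> real"
  assumes [measurable]: "f \<in> borel_measurable M" "g \<in> borel_measurable M"
    and "integrable M (\<lambda>x. (f x)\<^sup>2)" "integrable M (\<lambda>x. (g x)\<^sup>2)"
  shows "integrable M (\<lambda>x. f x * g x)"
proof (rule Bochner_Integration.integrable_bound)
  show "integrable M (\<lambda>x. (f x)\<^sup>2 + (g x)\<^sup>2)" using assms by simp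
  have "\<bar>a * b\<bar> \<le> a\<^sup>2 + b\<^sup>2" for a b :: real
  proof -
    have "2 * (\<bar>a\<bar> * \<bar>b\<bar>) \<le> a\<^sup>2 + b\<^sup>2"
      using sum_squares_bound[of "\<bar>a\<bar>" "\<bar>b\<bar>"] by simp
    moreover have "0 \<le> \<bar>a\<bar> * \<bar>b\<bar>" by simp
    ultimately show ?thesis unfolding abs_mult by linarith
  qed
  then show "AE x in M. norm (f x * g x) \<le> norm ((f x)\<^sup>2 + (g x)\<^sup>2)" by simp
qed measurable

lemma integrable_power2_imp:
  fixes f :: "'a \<Rightarrow> real"
  assumes "f \<in> borel_measurable M" "integrable M (\<lambda>x. (f x)\<^sup>2)"
  shows "integrable M f"
  using integrable_mult_squares[OF assms(1) _ assms(2), of "\<lambda>_. 1"] by simp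

lemma integrable_power2_sum:
  fixes f :: "'i \<Rightarrow> 'a \<Rightarrow> real"
  assumes "finite A" and f: "\<And>i. i \<in> A \<Longrightarrow> f i \<in> borel_measurable M"
    and f2: "\<And>i. i \<in> A \<Longrightarrow> integrable M (\<lambda>x. (f i x)\<^sup>2)"
  shows "integrable M (\<lambda>x. (\<Sum>i\<in>A. f i x)\<^sup>2)"
  unfolding power2_eq_square sum_product
  by (intro Bochner_Integration.integrable_sum integrable_mult_squares f f2)

lemma expectation_abs_le_sqrt:
  fixes f :: "'a \<Rightarrow> real"
  assumes f: "f \<in> borel_measurable M" "integrable M (\<lambda>x. (f x)\<^sup>2)"
  shows "expectation (\<lambda>x. \<bar>f x\<bar>) \<le> sqrt (expectation (\<lambda>x. (f x)\<^sup>2))"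
proof (rule real_le_rsqrt)
  have "integrable M (\<lambda>x. \<bar>f x\<bar>)" using integrable_power2_imp[OF f] by simp
  then have "variance (\<lambda>x. \<bar>f x\<bar>) = expectation (\<lambda>x. (f x)\<^sup>2) - (expectation (\<lambda>x. \<bar>f x\<bar>))\<^sup>2"
    using f(2) by (subst variance_eq) simp_all
  then show "(expectation (\<lambda>x. \<bar>f x\<bar>))\<^sup>2 \<le> expectation (\<lambda>x. (f x)\<^sup>2)"
    using variance_positive[of "\<lambda>x. \<bar>f x\<bar>"] by simp
qed

end

section \<open>Independence of past, innovation and choice\<close>

text \<open>Merges mutually independent groups, each independent in itself, into one family indexed
  by pairs. A finite index set is cut into its sections \<open>L j\<close>. The intersection over a
  section is an event of the sigma-algebra of group \<open>j\<close>, so \<open>outer\<close>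
  factors over the groups and \<open>inner\<close> then factors inside each section.\<close>

lemma (in prob_space) indep_sets_Sigma:
  fixes E :: "'j \<Rightarrow> 'i \<Rightarrow> 'a set set"
  assumes outer: "indep_sets (\<lambda>j. sigma_sets (space M) (\<Union>i\<in>I j. E j i)) J"
    and inner: "\<And>j. j \<in> J \<Longrightarrow> indep_sets (E j) (I j)"
  shows "indep_sets (\<lambda>(j, i). E j i) (Sigma J I)"
proof (rule indep_setsI)
  fix ji assume "ji \<in> Sigma J I"
  then show "(case ji of (j, i) \<Rightarrow> E j i) \<subseteq> events"
    using inner unfolding indep_sets_def by auto
next
  fix A K assume K: "K \<noteq> {}" "K \<subseteq> Sigma J I" "finite K"
    and "\<forall>ji\<in>K. A ji \<in> (case ji of (j, i) \<Rightarrow> E j i)"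
  then have A: "\<And>j i. (j, i) \<in> K \<Longrightarrow> A (j, i) \<in> E j i" by auto
  define L where "L j = {i. (j, i) \<in> K}" for j
  have K_eq: "K = Sigma (fst ` K) L"
    by (force simp: L_def)
  have L: "L j \<noteq> {}" "L j \<subseteq> I j" "j \<in> J" if "j \<in> fst ` K" for j
    using that K by (auto simp: L_def)
  have fin_L: "finite (L j)" for j
    by (rule finite_subset[of _ "snd ` K"]) (force simp: L_def K)+
  have in_sigma: "(\<Inter>i\<in>L j. A (j, i)) \<in> sigma_sets (space M) (\<Union>i\<in>I j. E j i)"
    if j: "j \<in> fst ` K" for j
  proof -
    have "(\<Union>i\<in>I j. E j i) \<subseteq> Pow (space M)"
      using inner[OF L(3)[OF j]] sets.space_closed unfolding indep_sets_def by blast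
    then interpret sigma_algebra "space M" "sigma_sets (space M) (\<Union>i\<in>I j. E j i)"
      by (rule sigma_algebra_sigma_sets)
    show ?thesis
      using L[OF j] fin_L A by (intro finite_INT) (auto simp: L_def intro!: sigma_sets.Basic)
  qed
  have "(\<Inter>ji\<in>K. A ji) = (\<Inter>j\<in>fst ` K. \<Inter>i\<in>L j. A (j, i))"
    by (subst K_eq) auto
  also have "prob \<dots> = (\<Prod>j\<in>fst ` K. prob (\<Inter>i\<in>L j. A (j, i)))"
    using K L(3) in_sigma by (intro indep_setsD[OF outer]) blast+
  also have "\<dots> = (\<Prod>j\<in>fst ` K. \<Prod>i\<in>L j. prob (A (j, i)))"
    proof (intro prod.cong refl indep_setsD[OF inner])
    fix j assume j: "j \<in> fst ` K"
    show "L j \<noteq> {}" "L j \<subseteq> I j" "j \<in> J" by (fact L[OF j])+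
    show "finite (L j)" "\<forall>i\<in>L j. A (j, i) \<in> E j i"
      using fin_L A by (auto simp: L_def)
  qed
  also have "\<dots> = (\<Prod>ji\<in>Sigma (fst ` K) L. prob (A ji))"
    using K fin_L by (subst prod.Sigma) auto
  finally show "prob (\<Inter>ji\<in>K. A ji) = (\<Prod>ji\<in>K. prob (A ji))"
    using K_eq by simp
qed

text \<open>Steps up to time \<open>n\<close> read \<open>X\<close> only at indices attained by the
  innovation count. This later allows \<open>X\<close> to be cut off after index \<open>m\<close> on
  the event that the count is \<open>m\<close>.\<close>

lemma cb_step_cong:
  assumes "1 \<le> n" "\<And>j. 1 \<le> j \<Longrightarrow> j \<le> n \<Longrightarrow>
    X (innov_count eps j \<omega>) \<omega> = X' (innov_count eps j \<omega>) \<omega>"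
  shows "cb_step X eps v n \<omega> = cb_step X' eps v n \<omega>"
  using assms
proof (induction n rule: less_induct)
  case (less n)
  have "X (innov_count eps n \<omega>) \<omega> = X' (innov_count eps n \<omega>) \<omega>"
    using less.prems by blast
  moreover have "cb_step X eps v (v n \<omega>) \<omega> = cb_step X' eps v (v n \<omega>) \<omega>" if "1 \<le> v n \<omega> \<and> v n \<omega> < n"
    using that less.prems(2) by (intro less.IH) auto
  ultimately show ?case
    unfolding cb_step.simps[of X eps v n \<omega>] cb_step.simps[of X' eps v n \<omega>] by presburger
qed

lemma innov_count_mono: "j \<le> k \<Longrightarrow> innov_count eps j \<omega> \<le> innov_count eps k \<omega>"
  unfolding innov_count_def by (intro sum_mono2) auto

lemma innov_count_measurable:
  assumes "\<And>j. j \<in> {1..n} \<Longrightarrow> eps j \<in> measurable N (count_space UNIV)"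
  shows "innov_count eps n \<in> measurable N (count_space UNIV)"
proof -
  have "(\<lambda>\<omega>. \<Sum>j\<in>A. eps j \<omega>) \<in> measurable N (count_space UNIV)" if "finite A" "A \<subseteq> {1..n}" for A
    using that assms
  proof (induction A rule: finite_induct)
    case (insert a A)
    then have [measurable]: "eps a \<in> measurable N (count_space UNIV)"
      "(\<lambda>\<omega>. \<Sum>j\<in>A. eps j \<omega>) \<in> measurable N (count_space UNIV)" by auto
    show ?case using insert.hyps by simp
  qed simp
  from this[of "{1..n}"] show ?thesis
    unfolding innov_count_def[abs_def] by simp
qed

text \<open>Kept general in \<open>N\<close> because it is applied to small sub-sigma-algebras,
  where measurability is the statement that a step depends on certain inputs only.\<close>

lemma cb_step_measurable:
  assumes X: "\<And>i. X i \<in> borel_measurable N"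
    and eps1: "\<And>\<omega>. \<omega> \<in> space N \<Longrightarrow> eps 1 \<omega> = 1"
    and eps: "\<And>i. i \<in> {2..n} \<Longrightarrow> eps i \<in> measurable N (count_space UNIV)"
    and v: "\<And>i. i \<in> {2..n} \<Longrightarrow> v i \<in> measurable N (count_space UNIV)"
    and n: "1 \<le> n"
  shows "cb_step X eps v n \<in> borel_measurable N"
  using n eps v
proof (induction n rule: less_induct)
  case (less n)
  have eps_m: "eps j \<in> measurable N (count_space UNIV)" if "j \<in> {1..n}" for j
  proof (cases "j = 1")
    case True
    have "(\<lambda>_. 1) \<in> measurable N (count_space UNIV)" by simp
    then show ?thesis unfolding True using eps1
      by (subst measurable_cong[where g = "\<lambda>_. 1"]) auto
  next
    case False
    then show ?thesis using less.prems that by auto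
  qed
  \<comment> \<open>The index is itself random, but it takes countably many values.\<close>
  have X_i [measurable]: "(\<lambda>\<omega>. X (innov_count eps n \<omega>) \<omega>) \<in> borel_measurable N"
    using X innov_count_measurable[of n eps N, OF eps_m]
    by (rule measurable_compose_countable)
  show ?case
  proof (cases "n = 1")
    case True
    have "cb_step X eps v n \<omega> = X (innov_count eps n \<omega>) \<omega>" if "\<omega> \<in> space N" for \<omega>
      using eps1[OF that] unfolding True by (subst cb_step.simps) simp
    then show ?thesis using X_i by (subst measurable_cong) auto
  next
    case False
    then have [measurable]: "eps n \<in> measurable N (count_space UNIV)"
      "v n \<in> measurable N (count_space UNIV)"
      using less.prems by auto
    have prev: "cb_step X eps v i \<in> borel_measurable N" if "i \<in> {1..<n}" for i
      using that less.prems by (intro less.IH) auto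
    \<comment> \<open>The copied index is random as well: the copy becomes a finite sum over its
      possible values, and a value outside the guard leaves an empty sum, which is the default
      0.\<close>
    have eq: "cb_step X eps v n \<omega> = (if eps n \<omega> = 1 then X (innov_count eps n \<omega>) \<omega>
        else \<Sum>i\<in>{1..<n}. if v n \<omega> = i then - cb_step X eps v i \<omega> else 0)" for \<omega>
      unfolding cb_step.simps[of X eps v n \<omega>] by (simp add: sum.delta')
    have "(\<lambda>\<omega>. \<Sum>i\<in>{1..<n}. if v n \<omega> = i then - cb_step X eps v i \<omega> else 0) \<in> borel_measurable N"
    proof (rule borel_measurable_sum)
      fix i assume "i \<in> {1..<n}"
      note prev[OF this, measurable]
      show "(\<lambda>\<omega>. if v n \<omega> = i then - cb_step X eps v i \<omega> else 0) \<in> borel_measurable N"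
        by measurable
    qed
    then show ?thesis
      unfolding eq[abs_def] using X_i by measurable
  qed
qed

section \<open>The inputs as one independent family\<close>

context counterbalanced
begin

text \<open>The first argument codes the sequence: 0 for \<open>X\<close>, 1 for \<open>eps\<close>,
  anything else for \<open>v\<close>. Systems of events put variables with values in different types
  into one family.\<close>

definition source :: "nat \<Rightarrow> nat \<Rightarrow> 'a set set" where
  "source s i =
     (if s = 0 then {X i -` A \<inter> space M | A. A \<in> sets borel}
      else if s = 1 then {eps i -` A \<inter> space M | A. A \<in> sets (count_space UNIV)}
      else {v i -` A \<inter> space M | A. A \<in> sets (count_space UNIV)})"

definition sites :: "(nat \<times> nat) set" where
  "sites = Sigma {..<3} (\<lambda>s. if s = 0 then {1..} else {2..})"

text \<open>The information carried by the inputs in \<open>J\<close>. Measurability with respect to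
  it replaces an explicit representation as a function of these inputs.\<close>

definition gen :: "(nat \<times> nat) set \<Rightarrow> 'a measure" where
  "gen J = sigma (space M) (\<Union>(s, i)\<in>J. source s i)"

lemma X_measurable [measurable]: "1 \<le> i \<Longrightarrow> X i \<in> borel_measurable M"
  and eps_measurable [measurable]: "2 \<le> i \<Longrightarrow> eps i \<in> measurable M (count_space UNIV)"
  and v_measurable [measurable]: "2 \<le> i \<Longrightarrow> v i \<in> measurable M (count_space UNIV)"
  using X_indep eps_indep v_indep unfolding indep_vars_def by auto

lemma less_3_cases: "s < 3 \<Longrightarrow> s = 0 \<or> s = 1 \<or> s = (2::nat)" by auto

lemma indep_sources: "indep_sets (\<lambda>(s, i). source s i) sites"
  unfolding sites_def
proof (rule indep_sets_Sigma)
  have "indep_sets (\<lambda>s. sigma_sets (space M)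
      (\<Union>i\<in>(if s = 0 then {1..} else {2..}). source s i)) {..<3} \<longleftrightarrow>
    indep_sets (\<lambda>k. [sigma_of_family M borel X {1..},
              sigma_of_family M (count_space UNIV) eps {2..},
              sigma_of_family M (count_space UNIV) v {2..}] ! k) {..<3}"
  proof (rule indep_sets_cong)
    fix s :: nat assume "s \<in> {..<3}"
    then consider "s = 0" | "s = 1" | "s = 2" using less_3_cases[of s] by auto
    then show "sigma_sets (space M) (\<Union>i\<in>(if s = 0 then {1..} else {2..}). source s i) =
      [sigma_of_family M borel X {1..}, sigma_of_family M (count_space UNIV) eps {2..},
       sigma_of_family M (count_space UNIV) v {2..}] ! s"
      by cases (simp_all add: source_def sigma_of_family_def)
  qed simp
  then show "indep_sets (\<lambda>s. sigma_sets (space M)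
      (\<Union>i\<in>(if s = 0 then {1..} else {2..}). source s i)) {..<3}"
    using seqs_indep by simp
next
  fix s :: nat assume "s \<in> {..<3}"
  then consider "s = 0" | "s = 1" | "s = 2" using less_3_cases[of s] by auto
  then show "indep_sets (source s) (if s = 0 then {1..} else {2..})"
    using X_indep eps_indep v_indep
    by cases (simp_all add: source_def[abs_def] indep_vars_def2)
qed

lemma source_events: "(s, i) \<in> sites \<Longrightarrow> source s i \<subseteq> events"
  using indep_sources unfolding indep_sets_def by auto

lemma source_Pow: "(\<Union>(s, i)\<in>J. source s i) \<subseteq> Pow (space M)"
  by (auto simp: source_def split: if_splits)

lemma space_gen [simp]: "space (gen J) = space M"
  and sets_gen: "sets (gen J) = sigma_sets (space M) (\<Union>(s, i)\<in>J. source s i)"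
  using source_Pow unfolding gen_def by (simp_all add: space_measure_of sets_measure_of)

lemma measurable_gen_M: "J \<subseteq> sites \<Longrightarrow> f \<in> measurable (gen J) N \<Longrightarrow> f \<in> measurable M N"
proof -
  assume J: "J \<subseteq> sites" and f: "f \<in> measurable (gen J) N"
  have "sets (gen J) \<subseteq> sets M"
    unfolding sets_gen using J source_events
    by (intro sets.sigma_sets_subset) blast
  then show "f \<in> measurable M N"
    using f unfolding measurable_def by auto
qed

lemma gen_X: "(0, i) \<in> J \<Longrightarrow> X i \<in> borel_measurable (gen J)"
  and gen_eps: "(1, i) \<in> J \<Longrightarrow> eps i \<in> measurable (gen J) (count_space UNIV)"
  and gen_v: "(2, i) \<in> J \<Longrightarrow> v i \<in> measurable (gen J) (count_space UNIV)"
proof -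
  have *: "f \<in> measurable (gen J) N"
    if "(s, i) \<in> J" "source s i = {f -` A \<inter> space M | A. A \<in> sets N}" "space N = UNIV"
    for f :: "'a \<Rightarrow> 'b" and N s i
  proof (rule measurableI)
    fix A assume "A \<in> sets N"
    then have "f -` A \<inter> space M \<in> source s i" unfolding that(2) by blast
    then show "f -` A \<inter> space (gen J) \<in> sets (gen J)"
      using that(1) unfolding sets_gen space_gen by (intro sigma_sets.Basic) blast
  qed (use that(3) in simp)
  show "(0, i) \<in> J \<Longrightarrow> X i \<in> borel_measurable (gen J)"
    by (rule *[of 0 i]) (simp_all add: source_def)
  show "(1, i) \<in> J \<Longrightarrow> eps i \<in> measurable (gen J) (count_space UNIV)"
    by (rule *[of 1 i]) (simp_all add: source_def)
  show "(2, i) \<in> J \<Longrightarrow> v i \<in> measurable (gen J) (count_space UNIV)"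
    by (rule *[of 2 i]) (simp_all add: source_def)
qed

lemma Int_stable_vimage:
  "Int_stable {f -` A \<inter> S | A. A \<in> sets N}"
proof (rule Int_stableI, safe)
  fix A B assume "A \<in> sets N" "B \<in> sets N"
  then show "\<exists>C. f -` A \<inter> S \<inter> (f -` B \<inter> S) = f -` C \<inter> S \<and> C \<in> sets N"
    by (intro exI[of _ "A \<inter> B"]) auto
qed

text \<open>Each source is stable under intersections, so grouping an independent family along
  disjoint index sets gives independent sigma-algebras. Every later independence claim is thereby
  reduced to the disjointness of two sets of inputs.\<close>

lemma indep_var_gen:
  fixes f g :: "'a \<Rightarrow> 'b :: topological_space"
  assumes "J \<subseteq> sites" "K \<subseteq> sites" "J \<inter> K = {}"
    and f: "f \<in> borel_measurable (gen J)" and g: "g \<in> borel_measurable (gen K)"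
  shows "indep_var borel f borel g"
proof -
  define I where "I b = (if b then J else K)" for b
  have "indep_sets (\<lambda>b. sigma_sets (space M) (\<Union>ji\<in>I b. case ji of (s, i) \<Rightarrow> source s i)) UNIV"
  proof (rule indep_sets_collect_sigma)
    show "indep_sets (\<lambda>(s, i). source s i) (\<Union>b\<in>UNIV. I b)"
      by (rule indep_sets_mono_index[OF _ indep_sources]) (use assms in \<open>auto simp: I_def UNIV_bool\<close>)
    show "Int_stable (case ji of (s, i) \<Rightarrow> source s i)" for ji
      using Int_stable_vimage[where N = borel] Int_stable_vimage[where N = "count_space UNIV"]
      by (auto simp: source_def split: prod.split)
    show "disjoint_family I"
      using assms(3) by (auto simp: disjoint_family_on_def I_def)
  qed
  then have "indep_sets (\<lambda>b. sets (gen (I b))) UNIV"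
    by (simp add: sets_gen)
  then have "indep_set (sigma_sets (space M) {f -` A \<inter> space M |A. A \<in> sets borel})
     (sigma_sets (space M) {g -` A \<inter> space M |A. A \<in> sets borel})"
    unfolding indep_set_def
  proof (rule indep_sets_mono_sets)
    have sub: "sigma_sets (space M) {h -` A \<inter> space M |A. A \<in> sets borel} \<subseteq> sets (gen L)"
      if "h \<in> borel_measurable (gen L)" for h :: "'a \<Rightarrow> 'b" and L
      unfolding space_gen[of L, symmetric]
      using measurable_sets[OF that] by (intro sets.sigma_sets_subset) auto
    show "(case b of True \<Rightarrow> sigma_sets (space M) {f -` A \<inter> space M |A. A \<in> sets borel}
        | False \<Rightarrow> sigma_sets (space M) {g -` A \<inter> space M |A. A \<in> sets borel}) \<subseteq> sets (gen (I b))" for b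
      using sub[OF f] sub[OF g] by (cases b) (simp_all add: I_def)
  qed
  then show ?thesis
    unfolding indep_var_eq
    using measurable_gen_M[OF assms(1) f] measurable_gen_M[OF assms(2) g] by simp
qed

lemma expectation_mult_gen:
  fixes f g :: "'a \<Rightarrow> 'b :: {second_countable_topology, banach, real_normed_field}"
  assumes "J \<subseteq> sites" "K \<subseteq> sites" "J \<inter> K = {}"
    and "f \<in> borel_measurable (gen J)" "g \<in> borel_measurable (gen K)"
    and "integrable M f" "integrable M g"
  shows "integrable M (\<lambda>\<omega>. f \<omega> * g \<omega>)"
    and "(\<integral>\<omega>. f \<omega> * g \<omega> \<partial>M) = (\<integral>\<omega>. f \<omega> \<partial>M) * (\<integral>\<omega>. g \<omega> \<partial>M)"
  using indep_var_gen[OF assms(1-5)] assms(6,7)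
  by (auto intro: indep_var_integrable indep_var_lebesgue_integral)

section \<open>The past of the walk\<close>

abbreviation innov :: "nat \<Rightarrow> 'a \<Rightarrow> nat" where
  "innov \<equiv> innov_count eps"

abbreviation step :: "nat \<Rightarrow> 'a \<Rightarrow> real" where
  "step \<equiv> cb_step X eps v"

text \<open>Coins and choices up to time \<open>k\<close>, together with the variables
  \<open>X i\<close> for \<open>i\<close> in \<open>B\<close>. The set \<open>B\<close> is a
  parameter because the number of variables consumed by time \<open>k\<close> is random.\<close>

definition past :: "nat set \<Rightarrow> nat \<Rightarrow> (nat \<times> nat) set" where
  "past B k = {0} \<times> B \<union> {1, 2} \<times> {2..k}"

text \<open>Setting \<open>X\<close> to zero outside \<open>B\<close> makes the resulting steps
  measurable with respect to \<open>past B k\<close> on the whole space, and not only on the event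
  where they agree with the true steps.\<close>

definition restr :: "nat set \<Rightarrow> nat \<Rightarrow> 'a \<Rightarrow> real" where
  "restr B i = (if i \<in> B then X i else (\<lambda>_. 0))"

lemma past_sites: "B \<subseteq> {1..} \<Longrightarrow> past B k \<subseteq> sites"
  by (auto simp: past_def sites_def)

lemma restr_step_measurable:
  assumes "1 \<le> j" "j \<le> k"
  shows "cb_step (restr B) eps v j \<in> borel_measurable (gen (past B k))"
proof (rule cb_step_measurable)
  show "restr B i \<in> borel_measurable (gen (past B k))" for i
    by (cases "i \<in> B") (auto simp: restr_def past_def intro!: gen_X)
qed (use assms eps_1 in \<open>auto simp: past_def intro!: gen_eps[simplified] gen_v\<close>)

lemma innov_measurable_gen:
  "innov k \<in> measurable (gen (past B k)) (count_space UNIV)"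
proof (rule innov_count_measurable)
  fix j assume j: "j \<in> {1..k}"
  show "eps j \<in> measurable (gen (past B k)) (count_space UNIV)"
  proof (cases "j = 1")
    case True
    then show ?thesis using eps_1
      by (subst measurable_cong[where g = "\<lambda>_. 1"]) auto
  next
    case False
    then show ?thesis using j by (intro gen_eps) (auto simp: past_def)
  qed
qed

lemma innov_ge_1: "\<omega> \<in> space M \<Longrightarrow> 1 \<le> k \<Longrightarrow> 1 \<le> innov k \<omega>"
  using innov_count_mono[of 1 k eps \<omega>] eps_1[of \<omega>] by (simp add: innov_count_def)

lemma restr_step_eq:
  assumes \<omega>: "\<omega> \<in> space M" and "1 \<le> j" "{1..innov j \<omega>} \<subseteq> B"
  shows "cb_step (restr B) eps v j \<omega> = step j \<omega>"
proof (rule cb_step_cong)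
  fix i assume i: "1 \<le> i" "i \<le> j"
  have "innov i \<omega> \<in> B"
    using innov_ge_1[OF \<omega> i(1)] innov_count_mono[OF i(2), of eps \<omega>] assms(3) by auto
  then show "restr B (innov i \<omega>) \<omega> = X (innov i \<omega>) \<omega>"
    by (simp add: restr_def)
qed fact

lemma step_measurable_gen:
  assumes "1 \<le> j" "j \<le> k"
  shows "step j \<in> borel_measurable (gen (past {1..} k))"
proof (subst measurable_cong)
  show "step j \<omega> = cb_step (restr {1..}) eps v j \<omega>" if "\<omega> \<in> space (gen (past {1..} k))" for \<omega>
    using that assms by (subst restr_step_eq) auto
  show "cb_step (restr {1..}) eps v j \<in> borel_measurable (gen (past {1..} k))"
    by (rule restr_step_measurable[OF assms])
qed

lemma step_measurable: "1 \<le> j \<Longrightarrow> step j \<in> borel_measurable M"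
  using measurable_gen_M[OF past_sites step_measurable_gen[of j j]] by auto

lemma sum_step_measurable:
  fixes g :: "real \<Rightarrow> real"
  assumes [measurable]: "g \<in> borel_measurable borel"
  shows "(\<lambda>\<omega>. \<Sum>j=1..k. g (step j \<omega>)) \<in> borel_measurable M"
proof (rule borel_measurable_sum)
  fix j assume "j \<in> {1..k}"
  then have [measurable]: "step j \<in> borel_measurable M" by (intro step_measurable) auto
  show "(\<lambda>\<omega>. g (step j \<omega>)) \<in> borel_measurable M" by measurable
qed

section \<open>Laws of the single inputs\<close>

lemma X_1_integral:
  fixes G :: "real \<Rightarrow> 'b :: {second_countable_topology, banach}"
  assumes [measurable]: "G \<in> borel_measurable borel" and i: "1 \<le> i"
  shows "integrable M (\<lambda>\<omega>. G (X i \<omega>)) \<longleftrightarrow> integrable M (\<lambda>\<omega>. G (X 1 \<omega>))"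
    and "(\<integral>\<omega>. G (X i \<omega>) \<partial>M) = (\<integral>\<omega>. G (X 1 \<omega>) \<partial>M)"
proof -
  have [measurable]: "X i \<in> borel_measurable M" "X 1 \<in> borel_measurable M"
    using i by simp_all
  have eq: "distr M borel (X i) = distr M borel (X 1)" using X_law i by simp
  show "integrable M (\<lambda>\<omega>. G (X i \<omega>)) \<longleftrightarrow> integrable M (\<lambda>\<omega>. G (X 1 \<omega>))"
    using integrable_distr_eq[of "X i" M borel G] integrable_distr_eq[of "X 1" M borel G] eq by simp
  show "(\<integral>\<omega>. G (X i \<omega>) \<partial>M) = (\<integral>\<omega>. G (X 1 \<omega>) \<partial>M)"
    using integral_distr[of "X i" M borel G] integral_distr[of "X 1" M borel G] eq by simp
qed

lemma AE_eps: "2 \<le> n \<Longrightarrow> AE \<omega> in M. eps n \<omega> = 0 \<or> eps n \<omega> = 1"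
proof -
  assume n: "2 \<le> n"
  have [measurable]: "eps n \<in> measurable M (count_space UNIV)" using n by simp
  have "prob ({\<omega> \<in> space M. eps n \<omega> = 0} \<union> {\<omega> \<in> space M. eps n \<omega> = 1}) =
      prob {\<omega> \<in> space M. eps n \<omega> = 0} + prob {\<omega> \<in> space M. eps n \<omega> = 1}"
    by (rule finite_measure_Union) auto
  also have "\<dots> = 1" using eps_law_0[OF n] eps_law_1[OF n] by simp
  also have "{\<omega> \<in> space M. eps n \<omega> = 0} \<union> {\<omega> \<in> space M. eps n \<omega> = 1} =
      {\<omega> \<in> space M. eps n \<omega> = 0 \<or> eps n \<omega> = 1}" by auto
  finally show ?thesis by (simp add: prob_Collect_eq_1)
qed

lemma prob_v: "2 \<le> n \<Longrightarrow> j \<in> {1..n - 1} \<Longrightarrow> prob {\<omega> \<in> space M. v n \<omega> = j} = 1 / real (n - 1)"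
proof -
  assume n: "2 \<le> n" and j: "j \<in> {1..n - 1}"
  have [measurable]: "v n \<in> measurable M (count_space UNIV)" using n by simp
  have "prob {\<omega> \<in> space M. v n \<omega> = j} = measure (distr M (count_space UNIV) (v n)) {j}"
    by (subst measure_distr) (auto intro!: arg_cong[where f = prob])
  also have "\<dots> = 1 / real (n - 1)"
    using n j by (subst v_law[OF n]) (simp add: measure_pmf_single)
  finally show ?thesis .
qed

lemma AE_v: "2 \<le> n \<Longrightarrow> AE \<omega> in M. v n \<omega> \<in> {1..n - 1}"
proof -
  assume n: "2 \<le> n"
  have [measurable]: "v n \<in> measurable M (count_space UNIV)" using n by simp
  have "AE x in distr M (count_space UNIV) (v n). x \<in> {1..n - 1}"
    using n by (subst v_law[OF n]) (simp add: AE_measure_pmf_iff)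
  then show ?thesis by (rule AE_distrD[rotated]) simp
qed

lemma AE_innov_le: "1 \<le> k \<Longrightarrow> AE \<omega> in M. innov k \<omega> \<le> k"
proof (induction k rule: nat_induct_at_least)
  case base
  then show ?case using eps_1 by (intro AE_I2) (simp add: innov_count_def)
next
  case (Suc n)
  have "AE \<omega> in M. eps (Suc n) \<omega> = 0 \<or> eps (Suc n) \<omega> = 1"
    using Suc.hyps by (intro AE_eps) auto
  with Suc.IH show ?case
    by eventually_elim (auto simp: innov_count_def)
qed

text \<open>A copy follows the past by an independent uniform choice; an innovation uses the variable
  with index \<open>innov k \<omega> + 1\<close>. On the event \<open>innov k \<omega> = m\<close> the past is a function of the first
  \<open>m\<close> variables only, which makes it independent of \<open>X (m + 1)\<close>.\<close>

lemma step_expectation: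
  fixes \<psi> G :: "real \<Rightarrow> 'b :: {second_countable_topology, banach, real_normed_field}"
    and g :: "real \<Rightarrow> real"
  defines "Z \<equiv> \<lambda>k \<omega>. \<psi> (\<Sum>j=1..k. g (step j \<omega>))"
  assumes [measurable]: "\<psi> \<in> borel_measurable borel" "G \<in> borel_measurable borel"
      "g \<in> borel_measurable borel"
    and k: "1 \<le> k"
    and int_Z: "integrable M (Z k)"
    and int_G: "integrable M (\<lambda>\<omega>. G (X 1 \<omega>))"
    and int_ZG: "\<And>j. j \<in> {1..k} \<Longrightarrow> integrable M (\<lambda>\<omega>. Z k \<omega> * G (- step j \<omega>))"
  shows "integrable M (\<lambda>\<omega>. Z k \<omega> * G (step (Suc k) \<omega>))" (is ?int)
    and "(\<integral>\<omega>. Z k \<omega> * G (step (Suc k) \<omega>) \<partial>M) =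
      of_real p * (\<integral>\<omega>. Z k \<omega> \<partial>M) * (\<integral>\<omega>. G (X 1 \<omega>) \<partial>M) +
      of_real ((1 - p) / k) * (\<Sum>j=1..k. \<integral>\<omega>. Z k \<omega> * G (- step j \<omega>) \<partial>M)" (is ?eq)
proof -
  define n where "n = Suc k"
  have n: "2 \<le> n" "1 \<le> n" using k by (auto simp: n_def)
  have eps_n [measurable]: "eps n \<in> measurable M (count_space UNIV)"
    and v_n [measurable]: "v n \<in> measurable M (count_space UNIV)" using n by simp_all
  have innov_k [measurable]: "innov k \<in> measurable M (count_space UNIV)"
    by (rule measurable_gen_M[OF past_sites innov_measurable_gen[of k "{}"]]) simp

  define I :: "'a \<Rightarrow> 'b" where "I \<omega> = (if eps n \<omega> = 1 then 1 else 0)" for \<omega>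
  \<comment> \<open>\<open>C j\<close> indicates that time \<open>n\<close> copies step
    \<open>j\<close>; \<open>I\<close> above indicates an innovation.\<close>
  define C :: "nat \<Rightarrow> 'a \<Rightarrow> 'b" where
    "C j \<omega> = (if eps n \<omega> = 0 then 1 else 0) * (if v n \<omega> = j then 1 else 0)" for j \<omega>
  \<comment> \<open>On the event \<open>innov k \<omega> = m\<close> this is \<open>Z k\<close>, but
    computed with \<open>X\<close> cut off after index \<open>m\<close>, so that it is a function of
    \<open>past {1..m} k\<close> everywhere.\<close>
  define U where "U m \<omega> =
    (if innov k \<omega> = m then \<psi> (\<Sum>j=1..k. g (cb_step (restr {1..m}) eps v j \<omega>)) else 0)" for m \<omega>

  have int_ind: "integrable M (\<lambda>\<omega>. if P \<omega> then 1 else 0 :: 'b)"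
    and E_ind: "(\<integral>\<omega>. (if P \<omega> then 1 else 0 :: 'b) \<partial>M) = of_real (prob {\<omega> \<in> space M. P \<omega>})"
    if [measurable]: "Measurable.pred M P" for P
  proof -
    have *: "(if P \<omega> then 1 else 0 :: 'b) = indicator {\<omega> \<in> space M. P \<omega>} \<omega> *\<^sub>R 1"
      if "\<omega> \<in> space M" for \<omega> using that by simp
    have **: "integrable M (indicat_real {\<omega> \<in> space M. P \<omega>})"
      by (simp add: integrable_indicator_iff emeasure_eq_measure)
    show "integrable M (\<lambda>\<omega>. if P \<omega> then 1 else 0 :: 'b)"
      using integrable_scaleR_left[OF **] by (subst Bochner_Integration.integrable_cong[OF refl *])
    show "(\<integral>\<omega>. (if P \<omega> then 1 else 0 :: 'b) \<partial>M) = of_real (prob {\<omega> \<in> space M. P \<omega>})"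
      by (subst Bochner_Integration.integral_cong[OF refl *])
        (simp_all add: of_real_def integral_scaleR_left[OF **])
  qed

  have I_gen: "I \<in> borel_measurable (gen {(1, n)})"
  proof -
    have [measurable]: "eps n \<in> measurable (gen {(1, n)}) (count_space UNIV)"
      by (rule gen_eps) simp
    show ?thesis unfolding I_def[abs_def] by measurable
  qed
  have int_I: "integrable M I" and E_I: "integral\<^sup>L M I = of_real p"
    using int_ind[of "\<lambda>\<omega>. eps n \<omega> = 1"] E_ind[of "\<lambda>\<omega>. eps n \<omega> = 1"] eps_law_1[OF n(1)]
    by (simp_all add: I_def[abs_def])

  have C: "C j \<in> borel_measurable (gen {(1, n), (2, n)})" "integrable M (C j)"
    "j \<in> {1..k} \<Longrightarrow> integral\<^sup>L M (C j) = of_real ((1 - p) / k)" for j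
  proof -
    have [measurable]: "eps n \<in> measurable (gen {(1, n)}) (count_space UNIV)"
      by (rule gen_eps) simp
    have [measurable]: "v n \<in> measurable (gen {(2, n)}) (count_space UNIV)"
      by (rule gen_v) simp
    have [measurable]: "eps n \<in> measurable (gen {(1, n), (2, n)}) (count_space UNIV)"
      by (rule gen_eps) simp
    have [measurable]: "v n \<in> measurable (gen {(1, n), (2, n)}) (count_space UNIV)"
      by (rule gen_v) simp
    show "C j \<in> borel_measurable (gen {(1, n), (2, n)})"
      unfolding C_def[abs_def] by measurable
    have e: "(\<lambda>\<omega>. if eps n \<omega> = 0 then 1 else 0 :: 'b) \<in> borel_measurable (gen {(1, n)})"
      and w: "(\<lambda>\<omega>. if v n \<omega> = j then 1 else 0 :: 'b) \<in> borel_measurable (gen {(2, n)})"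
      by measurable
    note * = expectation_mult_gen[of "{(1, n)}" "{(2, n)}"
      "\<lambda>\<omega>. if eps n \<omega> = 0 then 1 else 0 :: 'b" "\<lambda>\<omega>. if v n \<omega> = j then 1 else 0 :: 'b"]
    have s: "{(1, n)} \<subseteq> sites" "{(2, n)} \<subseteq> sites" using n by (auto simp: sites_def)
    show "integrable M (C j)"
      unfolding C_def[abs_def] using s by (intro *(1) int_ind e w) auto
    show "integral\<^sup>L M (C j) = of_real ((1 - p) / k)" if "j \<in> {1..k}"
    proof -
      have "integral\<^sup>L M (C j) = (\<integral>\<omega>. (if eps n \<omega> = 0 then 1 else 0 :: 'b) \<partial>M) *
          (\<integral>\<omega>. (if v n \<omega> = j then 1 else 0 :: 'b) \<partial>M)"
        unfolding C_def[abs_def] using s by (intro *(2) int_ind e w) auto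
      also have "\<dots> = of_real ((1 - p) * (1 / k))"
        using eps_law_0[OF n(1)] prob_v[of n j] n that
        by (simp add: E_ind n_def flip: of_real_mult)
      finally show ?thesis by simp
    qed
  qed

  have U_eq: "U m \<omega> = (if innov k \<omega> = m then Z k \<omega> else 0)" if "\<omega> \<in> space M" for m \<omega>
  proof (cases "innov k \<omega> = m")
    case True
    have "cb_step (restr {1..m}) eps v j \<omega> = step j \<omega>" if "j \<in> {1..k}" for j
      using that True innov_count_mono[of j k eps \<omega>] \<open>\<omega> \<in> space M\<close> by (intro restr_step_eq) auto
    then show ?thesis using True by (simp add: U_def Z_def)
  qed (simp add: U_def)
  have U_gen: "U m \<in> borel_measurable (gen (past {1..m} k))" for m
  proof -
    have [measurable]: "innov k \<in> measurable (gen (past {1..m} k)) (count_space UNIV)"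
      by (rule innov_measurable_gen)
    have [measurable]: "(\<lambda>\<omega>. \<Sum>j=1..k. g (cb_step (restr {1..m}) eps v j \<omega>))
        \<in> borel_measurable (gen (past {1..m} k))"
    proof (rule borel_measurable_sum)
      fix j assume "j \<in> {1..k}"
      then have [measurable]: "cb_step (restr {1..m}) eps v j \<in> borel_measurable (gen (past {1..m} k))"
        by (intro restr_step_measurable) auto
      show "(\<lambda>\<omega>. g (cb_step (restr {1..m}) eps v j \<omega>)) \<in> borel_measurable (gen (past {1..m} k))"
        by measurable
    qed
    show ?thesis unfolding U_def[abs_def] by measurable
  qed
  have int_U: "integrable M (U m)" for m
  proof (rule Bochner_Integration.integrable_bound[OF int_Z])
    show "U m \<in> borel_measurable M"
      by (rule measurable_gen_M[OF past_sites U_gen]) auto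
  qed (auto simp: U_eq intro!: AE_I2)

  have IG: "(\<lambda>\<omega>. I \<omega> * G (X (Suc m) \<omega>)) \<in> borel_measurable (gen {(1, n), (0, Suc m)})"
    "integrable M (\<lambda>\<omega>. I \<omega> * G (X (Suc m) \<omega>))"
    "(\<integral>\<omega>. I \<omega> * G (X (Suc m) \<omega>) \<partial>M) = of_real p * (\<integral>\<omega>. G (X 1 \<omega>) \<partial>M)" for m
  proof -
    have [measurable]: "eps n \<in> measurable (gen {(1, n), (0, Suc m)}) (count_space UNIV)"
      by (rule gen_eps) simp
    have [measurable]: "X (Suc m) \<in> borel_measurable (gen {(1, n), (0, Suc m)})"
      by (rule gen_X) simp
    have [measurable]: "X (Suc m) \<in> borel_measurable (gen {(0, Suc m)})"
      by (rule gen_X) simp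
    have Gm: "(\<lambda>\<omega>. G (X (Suc m) \<omega>)) \<in> borel_measurable (gen {(0, Suc m)})"
      by measurable
    show "(\<lambda>\<omega>. I \<omega> * G (X (Suc m) \<omega>)) \<in> borel_measurable (gen {(1, n), (0, Suc m)})"
      unfolding I_def[abs_def] by measurable
    have s: "{(1, n)} \<subseteq> sites" "{(0, Suc m)} \<subseteq> sites" using n by (auto simp: sites_def)
    have G: "integrable M (\<lambda>\<omega>. G (X (Suc m) \<omega>))"
      "(\<integral>\<omega>. G (X (Suc m) \<omega>) \<partial>M) = (\<integral>\<omega>. G (X 1 \<omega>) \<partial>M)"
      using X_1_integral[of G "Suc m"] int_G by simp_all
    show "integrable M (\<lambda>\<omega>. I \<omega> * G (X (Suc m) \<omega>))"
      using s by (intro expectation_mult_gen(1)[OF _ _ _ I_gen Gm int_I G(1)]) auto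
    show "(\<integral>\<omega>. I \<omega> * G (X (Suc m) \<omega>) \<partial>M) = of_real p * (\<integral>\<omega>. G (X 1 \<omega>) \<partial>M)"
      unfolding E_I[symmetric] G(2)[symmetric]
      using s by (intro expectation_mult_gen(2)[OF _ _ _ I_gen Gm int_I G(1)]) auto
  qed

  have UIG: "integrable M (\<lambda>\<omega>. U m \<omega> * (I \<omega> * G (X (Suc m) \<omega>)))"
    "(\<integral>\<omega>. U m \<omega> * (I \<omega> * G (X (Suc m) \<omega>)) \<partial>M) =
       integral\<^sup>L M (U m) * (of_real p * (\<integral>\<omega>. G (X 1 \<omega>) \<partial>M))" for m
  proof -
    \<comment> \<open>The index \<open>Suc m\<close> lies outside \<open>{1..m}\<close> and
      \<open>n\<close> lies beyond \<open>k\<close>: the cut-off in \<open>U m\<close> is what makes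
      the two sets of inputs disjoint.\<close>
    have s: "past {1..m} k \<subseteq> sites" "{(1, n), (0, Suc m)} \<subseteq> sites"
      "past {1..m} k \<inter> {(1, n), (0, Suc m)} = {}"
      using n by (auto simp: sites_def past_def n_def)
    show "integrable M (\<lambda>\<omega>. U m \<omega> * (I \<omega> * G (X (Suc m) \<omega>)))"
      by (rule expectation_mult_gen(1)[OF s U_gen IG(1) int_U IG(2)])
    show "(\<integral>\<omega>. U m \<omega> * (I \<omega> * G (X (Suc m) \<omega>)) \<partial>M) =
       integral\<^sup>L M (U m) * (of_real p * (\<integral>\<omega>. G (X 1 \<omega>) \<partial>M))"
      unfolding IG(3)[of m, symmetric]
      by (rule expectation_mult_gen(2)[OF s U_gen IG(1) int_U IG(2)])
  qed

  have ZGC: "integrable M (\<lambda>\<omega>. (Z k \<omega> * G (- step j \<omega>)) * C j \<omega>)"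
    "(\<integral>\<omega>. (Z k \<omega> * G (- step j \<omega>)) * C j \<omega> \<partial>M) =
       (\<integral>\<omega>. Z k \<omega> * G (- step j \<omega>) \<partial>M) * of_real ((1 - p) / k)" if j: "j \<in> {1..k}" for j
  proof -
    have s: "past {1..} k \<subseteq> sites" "{(1, n), (2, n)} \<subseteq> sites"
      "past {1..} k \<inter> {(1, n), (2, n)} = {}"
      using n by (auto simp: sites_def past_def n_def)
    have [measurable]: "step j \<in> borel_measurable (gen (past {1..} k))"
      using j by (intro step_measurable_gen) auto
    have [measurable]: "(\<lambda>\<omega>. \<Sum>j=1..k. g (step j \<omega>)) \<in> borel_measurable (gen (past {1..} k))"
    proof (rule borel_measurable_sum)
      fix j assume "j \<in> {1..k}"
      then have [measurable]: "step j \<in> borel_measurable (gen (past {1..} k))"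
        by (intro step_measurable_gen) auto
      show "(\<lambda>\<omega>. g (step j \<omega>)) \<in> borel_measurable (gen (past {1..} k))"
        by measurable
    qed
    have m: "(\<lambda>\<omega>. Z k \<omega> * G (- step j \<omega>)) \<in> borel_measurable (gen (past {1..} k))"
      unfolding Z_def by measurable
    show "integrable M (\<lambda>\<omega>. (Z k \<omega> * G (- step j \<omega>)) * C j \<omega>)"
      by (rule expectation_mult_gen(1)[OF s m C(1) int_ZG[OF j] C(2)])
    show "(\<integral>\<omega>. (Z k \<omega> * G (- step j \<omega>)) * C j \<omega> \<partial>M) =
       (\<integral>\<omega>. Z k \<omega> * G (- step j \<omega>) \<partial>M) * of_real ((1 - p) / k)"
      unfolding C(3)[OF j, symmetric]
      by (rule expectation_mult_gen(2)[OF s m C(1) int_ZG[OF j] C(2)])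
  qed

  \<comment> \<open>At most one summand survives on almost every outcome: an innovation selects
    \<open>m = innov k \<omega>\<close>, a copy selects \<open>j = v n \<omega>\<close>. The first
    sum may stop at \<open>k\<close> because the innovation count is almost surely at most
    \<open>k\<close>.\<close>
  define R where "R \<omega> = (\<Sum>m\<in>{1..k}. U m \<omega> * (I \<omega> * G (X (Suc m) \<omega>))) +
    (\<Sum>j\<in>{1..k}. (Z k \<omega> * G (- step j \<omega>)) * C j \<omega>)" for \<omega>
  have AE_R: "AE \<omega> in M. Z k \<omega> * G (step (Suc k) \<omega>) = R \<omega>"
    using AE_innov_le[OF k] AE_eps[OF n(1)] AE_v[OF n(1)] AE_space
  proof eventually_elim
    case (elim \<omega>)
    have innov_k: "innov k \<omega> \<in> {1..k}" using innov_ge_1[OF elim(4) k] elim(1) by auto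
    show ?case
    proof (cases "eps n \<omega> = 1")
      case True
      then have "step n \<omega> = X (Suc (innov k \<omega>)) \<omega>"
        by (subst cb_step.simps) (simp add: innov_count_def n_def)
      moreover have "R \<omega> = (\<Sum>m\<in>{1..k}. if innov k \<omega> = m then Z k \<omega> * G (X (Suc m) \<omega>) else 0)"
      proof -
        have "I \<omega> = 1" "C j \<omega> = 0" for j
          using True by (simp_all add: I_def C_def)
        then have "R \<omega> = (\<Sum>m\<in>{1..k}. U m \<omega> * G (X (Suc m) \<omega>))"
          by (simp add: R_def)
        also have "\<dots> = (\<Sum>m\<in>{1..k}. if innov k \<omega> = m then Z k \<omega> * G (X (Suc m) \<omega>) else 0)"
          by (rule sum.cong) (simp_all add: U_eq[OF elim(4)])
        finally show ?thesis .
      qed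
      ultimately show ?thesis using innov_k by (simp add: sum.delta' n_def)
    next
      case False
      then have e0: "eps n \<omega> = 0" using elim(2) by simp
      then have "step n \<omega> = - step (v n \<omega>) \<omega>"
        using elim(3) n by (subst cb_step.simps) auto
      moreover have "R \<omega> = (\<Sum>j\<in>{1..k}. if v n \<omega> = j then Z k \<omega> * G (- step j \<omega>) else 0)"
      proof -
        have "I \<omega> = 0" using e0 by (simp add: I_def)
        then have "R \<omega> = (\<Sum>j\<in>{1..k}. (Z k \<omega> * G (- step j \<omega>)) * C j \<omega>)"
          by (simp add: R_def)
        also have "\<dots> = (\<Sum>j\<in>{1..k}. if v n \<omega> = j then Z k \<omega> * G (- step j \<omega>) else 0)"
          using e0 by (intro sum.cong) (simp_all add: C_def)
        finally show ?thesis .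
      qed
      ultimately show ?thesis using elim(3) by (simp add: sum.delta' n_def)
    qed
  qed
  have int_R: "integrable M R"
    unfolding R_def[abs_def] using UIG(1) ZGC(1)
    by (intro Bochner_Integration.integrable_add Bochner_Integration.integrable_sum) auto
  have meas: "(\<lambda>\<omega>. Z k \<omega> * G (step (Suc k) \<omega>)) \<in> borel_measurable M"
  proof -
    have [measurable]: "(\<lambda>\<omega>. \<Sum>j=1..k. g (step j \<omega>)) \<in> borel_measurable M"
      "step (Suc k) \<in> borel_measurable M"
      by (rule sum_step_measurable step_measurable, simp)+
    show ?thesis unfolding Z_def by measurable
  qed
  show ?int
    using int_R AE_R meas by (subst integrable_cong_AE[OF _ _ AE_R]) auto
  have "(\<integral>\<omega>. Z k \<omega> * G (step (Suc k) \<omega>) \<partial>M) = integral\<^sup>L M R"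
    using int_R meas by (intro integral_cong_AE AE_R) auto
  also have "\<dots> = (\<Sum>m\<in>{1..k}. integral\<^sup>L M (U m) * (of_real p * (\<integral>\<omega>. G (X 1 \<omega>) \<partial>M))) +
      (\<Sum>j\<in>{1..k}. (\<integral>\<omega>. Z k \<omega> * G (- step j \<omega>) \<partial>M) * of_real ((1 - p) / k))"
    unfolding R_def[abs_def] using UIG ZGC
    by (subst Bochner_Integration.integral_add)
       (auto simp: Bochner_Integration.integral_sum intro!: Bochner_Integration.integrable_sum sum.cong)
  also have "(\<Sum>m\<in>{1..k}. integral\<^sup>L M (U m) * (of_real p * (\<integral>\<omega>. G (X 1 \<omega>) \<partial>M))) =
      (\<Sum>m\<in>{1..k}. integral\<^sup>L M (U m)) * (of_real p * (\<integral>\<omega>. G (X 1 \<omega>) \<partial>M))"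
    by (simp add: sum_distrib_right)
  also have "(\<Sum>m\<in>{1..k}. integral\<^sup>L M (U m)) = (\<integral>\<omega>. (\<Sum>m\<in>{1..k}. U m \<omega>) \<partial>M)"
    using int_U by (simp add: Bochner_Integration.integral_sum)
  \<comment> \<open>The values of \<open>innov k\<close> partition the space up to a null set, so
    the pieces \<open>U m\<close> add up to \<open>Z k\<close>.\<close>
  also have "\<dots> = (\<integral>\<omega>. Z k \<omega> \<partial>M)"
  proof (rule integral_cong_AE)
    show "AE \<omega> in M. (\<Sum>m\<in>{1..k}. U m \<omega>) = Z k \<omega>"
      using AE_innov_le[OF k] AE_space
    proof eventually_elim
      case (elim \<omega>)
      then have "innov k \<omega> \<in> {1..k}" using innov_ge_1[OF elim(2) k] by auto
      then show ?case using elim(2) by (simp add: U_eq sum.delta')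
    qed
  qed (use int_U int_Z in auto)
  finally show ?eq
    by (simp add: sum_distrib_left mult_ac)
qed

section \<open>Integrals of functions of a single step\<close>

lemma step_1: "\<omega> \<in> space M \<Longrightarrow> step 1 \<omega> = X 1 \<omega>"
  using eps_1[of \<omega>] by (subst cb_step.simps) (simp add: innov_count_def)

text \<open>Copying reverses the sign, so integrability of \<open>G\<close> at the step and at its
  negative must be carried through the induction together.\<close>

lemma integrable_step:
  fixes G :: "real \<Rightarrow> 'b :: {second_countable_topology, banach, real_normed_field}"
  assumes G [measurable]: "G \<in> borel_measurable borel"
    and int: "integrable M (\<lambda>\<omega>. G (X 1 \<omega>))" "integrable M (\<lambda>\<omega>. G (- X 1 \<omega>))"
    and "1 \<le> k"
  shows "integrable M (\<lambda>\<omega>. G (step k \<omega>))" "integrable M (\<lambda>\<omega>. G (- step k \<omega>))"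
proof -
  have "integrable M (\<lambda>\<omega>. G (step k \<omega>)) \<and> integrable M (\<lambda>\<omega>. G (- step k \<omega>))"
    using \<open>1 \<le> k\<close>
  proof (induction k rule: less_induct)
    case (less k)
    show ?case
    proof (cases "k = 1")
      case True
      have "integrable M (\<lambda>\<omega>. G (step k \<omega>)) = integrable M (\<lambda>\<omega>. G (X 1 \<omega>))"
        "integrable M (\<lambda>\<omega>. G (- step k \<omega>)) = integrable M (\<lambda>\<omega>. G (- X 1 \<omega>))"
        unfolding True by (rule Bochner_Integration.integrable_cong; simp add: step_1[simplified])+
      then show ?thesis using int by blast
    next
      case False
      then obtain k' where k': "k = Suc k'" "1 \<le> k'"
        using less.prems by (cases k) auto
      have "integrable M (\<lambda>\<omega>. 1 * G (step (Suc k') \<omega>))"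
        by (rule step_expectation(1)[of "\<lambda>_. 1" G "\<lambda>_. 0"])
           (use less k' int in auto)
      moreover have "integrable M (\<lambda>\<omega>. 1 * G (- step (Suc k') \<omega>))"
        by (rule step_expectation(1)[of "\<lambda>_. 1" "\<lambda>x. G (- x)" "\<lambda>_. 0"])
           (use less k' int in auto)
      ultimately show ?thesis by (simp add: k')
    qed
  qed
  then show "integrable M (\<lambda>\<omega>. G (step k \<omega>))" "integrable M (\<lambda>\<omega>. G (- step k \<omega>))" by auto
qed

text \<open>A sign change is invisible to an even function. Its mean at a new step is therefore
  \<open>p\<close> times the innovation mean plus \<open>1 - p\<close> times an average of earlier
  means, and stays constant.\<close>

lemma even_step:
  fixes h :: "real \<Rightarrow> real"
  assumes [measurable]: "h \<in> borel_measurable borel" and even: "\<And>x. h (- x) = h x"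
    and int: "integrable M (\<lambda>\<omega>. h (X 1 \<omega>))" and k: "1 \<le> k"
  shows "integrable M (\<lambda>\<omega>. h (step k \<omega>))"
    and "expectation (\<lambda>\<omega>. h (step k \<omega>)) = expectation (\<lambda>\<omega>. h (X 1 \<omega>))"
proof -
  have int_step: "integrable M (\<lambda>\<omega>. h (step k \<omega>))" if "1 \<le> k" for k
    by (rule integrable_step) (use that int even in auto)
  then show "integrable M (\<lambda>\<omega>. h (step k \<omega>))" using k by blast
  show "expectation (\<lambda>\<omega>. h (step k \<omega>)) = expectation (\<lambda>\<omega>. h (X 1 \<omega>))"
    using k
  proof (induction k rule: less_induct)
    case (less k)
    show ?case
    proof (cases "k = 1")
      case True
      show ?thesis
        unfolding True by (rule Bochner_Integration.integral_cong) (simp_all add: step_1[simplified])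
    next
      case False
      then obtain n where n: "k = Suc n" "1 \<le> n"
        using less.prems by (cases k) auto
      have "expectation (\<lambda>\<omega>. 1 * h (step (Suc n) \<omega>)) =
        of_real p * expectation (\<lambda>\<omega>. 1) * expectation (\<lambda>\<omega>. h (X 1 \<omega>)) +
        of_real ((1 - p) / n) * (\<Sum>j=1..n. expectation (\<lambda>\<omega>. 1 * h (- step j \<omega>)))"
        by (rule step_expectation(2)[of "\<lambda>_. 1" h "\<lambda>_. 0"])
           (use n int int_step even in auto)
      also have "(\<Sum>j=1..n. expectation (\<lambda>\<omega>. 1 * h (- step j \<omega>))) =
          (\<Sum>j=1..n. expectation (\<lambda>\<omega>. h (X 1 \<omega>)))"
        using less.IH n by (intro sum.cong) (auto simp: even)
      finally show ?thesis using n by (simp add: prob_space field_simps)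
    qed
  qed
qed

end

section \<open>Second moments\<close>

locale counterbalanced_L2 = counterbalanced +
  assumes p_pos: "0 < p" and X_sq: "integrable M (\<lambda>\<omega>. (X 1 \<omega>)\<^sup>2)"
begin

lemma p_le_1: "p \<le> 1" using p by simp

definition m1 where "m1 = expectation (X 1)"
definition m2 where "m2 = expectation (\<lambda>\<omega>. (X 1 \<omega>)\<^sup>2)"
text \<open>The limiting velocity: a new step has mean \<open>m1\<close> with probability
  \<open>p\<close> and otherwise minus the running average, so that
  \<open>c = p * m1 - (1 - p) * c\<close>.\<close>

definition c where "c = p / (2 - p) * m1"

lemma c_eq: "p * m1 = (2 - p) * c"
  using p_le_1 by (simp add: c_def)

section \<open>The centred walk: drift and linear growth of the second moment\<close>

definition Y where "Y k \<omega> = (\<Sum>j=1..k. step j \<omega> - c)"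
definition V where "V k \<omega> = (\<Sum>j=1..k. (step j \<omega>)\<^sup>2)"

lemma X_int: "integrable M (X 1)"
  by (rule integrable_power2_imp[OF _ X_sq]) simp

lemma step_measurable_upto [measurable]: "j \<in> {1..k} \<Longrightarrow> step j \<in> borel_measurable M"
  by (intro step_measurable) auto

lemma Y_measurable [measurable]: "Y k \<in> borel_measurable M"
  using sum_step_measurable[of "\<lambda>x. x - c" k] unfolding Y_def[abs_def] by simp

lemma step_sq: "1 \<le> j \<Longrightarrow> integrable M (\<lambda>\<omega>. (step j \<omega>)\<^sup>2)"
  "1 \<le> j \<Longrightarrow> expectation (\<lambda>\<omega>. (step j \<omega>)\<^sup>2) = m2"
  using even_step[of "\<lambda>x. x\<^sup>2" j] X_sq by (simp_all add: m2_def)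

lemma step_int: "1 \<le> j \<Longrightarrow> integrable M (step j)"
  by (rule integrable_power2_imp[OF step_measurable step_sq(1)])

lemma sq_shift_int:
  fixes f :: "'a \<Rightarrow> real"
  assumes [measurable]: "f \<in> borel_measurable M" and "integrable M (\<lambda>\<omega>. (f \<omega>)\<^sup>2)"
  shows "integrable M (\<lambda>\<omega>. (f \<omega> + a)\<^sup>2)"
proof -
  have "integrable M f" using assms by (rule integrable_power2_imp)
  then have "integrable M (\<lambda>\<omega>. (f \<omega>)\<^sup>2 + a\<^sup>2 + 2 * a * f \<omega>)" using assms(2) by simp
  then show ?thesis by (simp add: power2_sum mult_ac)
qed

lemma Y_sq_int: "integrable M (\<lambda>\<omega>. (Y k \<omega>)\<^sup>2)"
  unfolding Y_def
proof (rule integrable_power2_sum)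
  fix j assume j: "j \<in> {1..k}"
  then have [measurable]: "step j \<in> borel_measurable M" by (rule step_measurable_upto)
  show "(\<lambda>\<omega>. step j \<omega> - c) \<in> borel_measurable M" by measurable
  show "integrable M (\<lambda>\<omega>. (step j \<omega> - c)\<^sup>2)"
    using sq_shift_int[of "step j" "- c"] step_sq j by simp
qed simp

lemma Y_int: "integrable M (Y k)"
  by (rule integrable_power2_imp[OF Y_measurable Y_sq_int])

text \<open>The conditional drift in weak form, with \<open>\<psi> (Y k)\<close> as test function.
  The identity for \<open>\<psi>\<close> yields the second moment of \<open>Y\<close>, the complex
  exponential yields the recursion for the characteristic functions.\<close>

lemma expectation_drift:
  fixes \<psi> :: "real \<Rightarrow> 'b :: {second_countable_topology, banach, real_normed_field}"
  assumes [measurable]: "\<psi> \<in> borel_measurable borel" and k: "1 \<le> k"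
    and int_Z: "integrable M (\<lambda>\<omega>. \<psi> (Y k \<omega>))"
    and int: "\<And>j. j \<in> {1..k} \<Longrightarrow> integrable M (\<lambda>\<omega>. \<psi> (Y k \<omega>) * of_real (step j \<omega>))"
  shows "integrable M (\<lambda>\<omega>. \<psi> (Y k \<omega>) * of_real (step (Suc k) \<omega> - c))"
    and "(\<integral>\<omega>. \<psi> (Y k \<omega>) * of_real (step (Suc k) \<omega> - c) \<partial>M) =
      - of_real ((1 - p) / k) * (\<integral>\<omega>. \<psi> (Y k \<omega>) * of_real (Y k \<omega>) \<partial>M)"
proof -
  have eq: "\<psi> (Y k \<omega>) * of_real (- step j \<omega> - c) =
      - (\<psi> (Y k \<omega>) * of_real (step j \<omega>)) - \<psi> (Y k \<omega>) * of_real c" for j \<omega>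
    by (simp add: algebra_simps)
  have int': "integrable M (\<lambda>\<omega>. \<psi> (Y k \<omega>) * of_real (- step j \<omega> - c))" if "j \<in> {1..k}" for j
    unfolding eq using int[OF that] int_Z by simp
  have int_X: "integrable M (\<lambda>\<omega>. of_real (X 1 \<omega> - c) :: 'b)"
    using X_int by simp
  note * = step_expectation[of \<psi> "\<lambda>x. of_real (x - c)" "\<lambda>x. x - c", OF _ _ _ k, folded Y_def, OF _ _ _ int_Z int_X int']
  show "integrable M (\<lambda>\<omega>. \<psi> (Y k \<omega>) * of_real (step (Suc k) \<omega> - c))"
    by (rule *) auto
  have "(\<integral>\<omega>. of_real (X 1 \<omega> - c) \<partial>M) = (of_real (m1 - c) :: 'b)"
    using X_int by (simp add: m1_def prob_space)
  moreover have "(\<Sum>j=1..k. \<integral>\<omega>. \<psi> (Y k \<omega>) * of_real (- step j \<omega> - c) \<partial>M) =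
      - (\<integral>\<omega>. \<psi> (Y k \<omega>) * of_real (Y k \<omega>) \<partial>M) - 2 * of_real (k * c) * (\<integral>\<omega>. \<psi> (Y k \<omega>) \<partial>M)"
  proof -
    have "(\<Sum>j=1..k. \<integral>\<omega>. \<psi> (Y k \<omega>) * of_real (- step j \<omega> - c) \<partial>M) =
        (\<integral>\<omega>. (\<Sum>j=1..k. \<psi> (Y k \<omega>) * of_real (- step j \<omega> - c)) \<partial>M)"
      using int' by (intro Bochner_Integration.integral_sum[symmetric]) auto
    also have "(\<lambda>\<omega>. \<Sum>j=1..k. \<psi> (Y k \<omega>) * of_real (- step j \<omega> - c)) =
        (\<lambda>\<omega>. - (\<psi> (Y k \<omega>) * of_real (Y k \<omega>)) - 2 * of_real (k * c) * \<psi> (Y k \<omega>))"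
    proof
      fix \<omega>
      have "(\<Sum>j=1..k. - step j \<omega> - c) = - Y k \<omega> - 2 * (k * c)"
        by (simp add: Y_def sum_subtractf sum_negf)
      moreover have "(\<Sum>j=1..k. \<psi> (Y k \<omega>) * of_real (- step j \<omega> - c)) =
          \<psi> (Y k \<omega>) * of_real (\<Sum>j=1..k. - step j \<omega> - c)"
        by (simp only: sum_distrib_left of_real_sum)
      ultimately have "(\<Sum>j=1..k. \<psi> (Y k \<omega>) * of_real (- step j \<omega> - c)) =
          \<psi> (Y k \<omega>) * of_real (- Y k \<omega> - 2 * (k * c))"
        by (simp only:)
      then show "(\<Sum>j=1..k. \<psi> (Y k \<omega>) * of_real (- step j \<omega> - c)) =
          - (\<psi> (Y k \<omega>) * of_real (Y k \<omega>)) - 2 * of_real (k * c) * \<psi> (Y k \<omega>)"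
        by (simp only: of_real_diff of_real_minus of_real_mult of_real_numeral) (simp add: algebra_simps)
    qed
    also have "(\<integral>\<omega>. - (\<psi> (Y k \<omega>) * of_real (Y k \<omega>)) - 2 * of_real (k * c) * \<psi> (Y k \<omega>) \<partial>M) =
        - (\<integral>\<omega>. \<psi> (Y k \<omega>) * of_real (Y k \<omega>) \<partial>M) - 2 * of_real (k * c) * (\<integral>\<omega>. \<psi> (Y k \<omega>) \<partial>M)"
    proof -
      have "integrable M (\<lambda>\<omega>. \<Sum>j=1..k. \<psi> (Y k \<omega>) * of_real (step j \<omega>) - \<psi> (Y k \<omega>) * of_real c)"
        using int int_Z by (intro Bochner_Integration.integrable_sum) auto
      also have "(\<lambda>\<omega>. \<Sum>j=1..k. \<psi> (Y k \<omega>) * of_real (step j \<omega>) - \<psi> (Y k \<omega>) * of_real c) =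
          (\<lambda>\<omega>. \<psi> (Y k \<omega>) * of_real (Y k \<omega>))"
        unfolding Y_def of_real_sum sum_distrib_left of_real_diff right_diff_distrib ..
      finally show ?thesis using int_Z by simp
    qed
    finally show ?thesis .
  qed
  moreover have "(\<integral>\<omega>. \<psi> (Y k \<omega>) * of_real (step (Suc k) \<omega> - c) \<partial>M) =
      of_real p * (\<integral>\<omega>. \<psi> (Y k \<omega>) \<partial>M) * (\<integral>\<omega>. of_real (X 1 \<omega> - c) \<partial>M) +
      of_real ((1 - p) / k) * (\<Sum>j=1..k. \<integral>\<omega>. \<psi> (Y k \<omega>) * of_real (- step j \<omega> - c) \<partial>M)"
    by (rule *) auto
  moreover have alg: "of_real b * z * of_real d + of_real r * (- a - 2 * of_real s * z) =
      of_real (b * d - r * (2 * s)) * z - of_real r * a" for a z :: 'b and b d r s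
    by (simp add: algebra_simps)
  ultimately have "(\<integral>\<omega>. \<psi> (Y k \<omega>) * of_real (step (Suc k) \<omega> - c) \<partial>M) =
      of_real (p * (m1 - c) - (1 - p) / k * (2 * (k * c))) * (\<integral>\<omega>. \<psi> (Y k \<omega>) \<partial>M)
      - of_real ((1 - p) / k) * (\<integral>\<omega>. \<psi> (Y k \<omega>) * of_real (Y k \<omega>) \<partial>M)"
    by (simp only: alg)
  \<comment> \<open>The deterministic part of the drift. A copy contributes
    \<open>- step j - c\<close>, so centring leaves \<open>- 2 * c\<close> on average, and the
    innovation term balances it exactly for this value of \<open>c\<close>.\<close>
  also have "p * (m1 - c) - (1 - p) / k * (2 * (k * c)) = 0"
  proof -
    have "(1 - p) / k * (2 * (k * c)) = 2 * ((1 - p) * c)" using k by simp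
    then show ?thesis using c_eq by (simp add: algebra_simps)
  qed
  finally show "(\<integral>\<omega>. \<psi> (Y k \<omega>) * of_real (step (Suc k) \<omega> - c) \<partial>M) =
      - of_real ((1 - p) / k) * (\<integral>\<omega>. \<psi> (Y k \<omega>) * of_real (Y k \<omega>) \<partial>M)"
    by simp
qed

text \<open>Bounds the second moment of \<open>step j - c\<close> for all \<open>j\<close>. The
  absolute values make the integrand even in \<open>X 1\<close>, so \<open>even_step\<close>
  applies, which it would not for \<open>(X 1 - c)\<close> squared.\<close>

definition B2 where "B2 = expectation (\<lambda>\<omega>. (\<bar>X 1 \<omega>\<bar> + \<bar>c\<bar>)\<^sup>2)"

lemma X_B2_int: "integrable M (\<lambda>\<omega>. (\<bar>X 1 \<omega>\<bar> + \<bar>c\<bar>)\<^sup>2)"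
  using X_sq by (intro sq_shift_int) auto

lemma B2_nonneg: "0 \<le> B2"
  unfolding B2_def by (rule Bochner_Integration.integral_nonneg) simp

lemma step_shift_sq:
  assumes "1 \<le> j"
  shows "integrable M (\<lambda>\<omega>. (step j \<omega> - c)\<^sup>2)" "expectation (\<lambda>\<omega>. (step j \<omega> - c)\<^sup>2) \<le> B2"
proof -
  note * = even_step[of "\<lambda>x. (\<bar>x\<bar> + \<bar>c\<bar>)\<^sup>2", OF _ _ X_B2_int assms]
  show 1: "integrable M (\<lambda>\<omega>. (step j \<omega> - c)\<^sup>2)"
    using sq_shift_int[of "step j" "- c"] step_sq step_measurable assms by simp
  have "(x - c)\<^sup>2 \<le> (\<bar>x\<bar> + \<bar>c\<bar>)\<^sup>2" for x
    by (rule power2_le_iff_abs_le[THEN iffD2]) auto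
  then have "expectation (\<lambda>\<omega>. (step j \<omega> - c)\<^sup>2) \<le> expectation (\<lambda>\<omega>. (\<bar>step j \<omega>\<bar> + \<bar>c\<bar>)\<^sup>2)"
    by (intro Bochner_Integration.integral_mono 1 *) auto
  also have "\<dots> = B2" unfolding B2_def by (rule *) auto
  finally show "expectation (\<lambda>\<omega>. (step j \<omega> - c)\<^sup>2) \<le> B2" .
qed

text \<open>Copies with reversed sign pull \<open>Y\<close> back towards zero: the cross term in the
  square of \<open>Y (Suc k)\<close> has nonpositive mean, and each step adds at most
  \<open>B2\<close>.\<close>

lemma Y_second_moment: "expectation (\<lambda>\<omega>. (Y k \<omega>)\<^sup>2) \<le> B2 * k"
proof (induction k)
  case 0
  then show ?case by (simp add: Y_def)
next
  case (Suc k)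
  show ?case
  proof (cases "k = 0")
    case True
    then show ?thesis using step_shift_sq(2)[of 1] by (simp add: Y_def)
  next
    case False
    have prod: "integrable M (\<lambda>\<omega>. Y k \<omega> * of_real (step j \<omega>))" if j: "j \<in> {1..k}" for j
    proof -
      have "integrable M (\<lambda>\<omega>. (step j \<omega>)\<^sup>2)" using j by (intro step_sq) simp
      from integrable_mult_squares[OF Y_measurable step_measurable_upto[OF j] Y_sq_int this]
      show ?thesis by simp
    qed
    have "1 \<le> k" using False by simp
    note drift' = expectation_drift[of "\<lambda>x. x" k, OF measurable_ident_sets[OF refl] this Y_int prod]
    have int: "integrable M (\<lambda>\<omega>. Y k \<omega> * (step (Suc k) \<omega> - c))"
      using drift'(1) by simp
    have drift: "expectation (\<lambda>\<omega>. Y k \<omega> * (step (Suc k) \<omega> - c)) =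
        - ((1 - p) / k) * expectation (\<lambda>\<omega>. (Y k \<omega>)\<^sup>2)"
      using drift'(2) by (simp add: power2_eq_square)
    have "(\<lambda>\<omega>. (Y (Suc k) \<omega>)\<^sup>2) =
        (\<lambda>\<omega>. (Y k \<omega>)\<^sup>2 + 2 * (Y k \<omega> * (step (Suc k) \<omega> - c)) + (step (Suc k) \<omega> - c)\<^sup>2)"
      by (rule ext) (simp add: Y_def power2_sum)
    then have "expectation (\<lambda>\<omega>. (Y (Suc k) \<omega>)\<^sup>2) = expectation (\<lambda>\<omega>. (Y k \<omega>)\<^sup>2) +
        2 * expectation (\<lambda>\<omega>. Y k \<omega> * (step (Suc k) \<omega> - c)) + expectation (\<lambda>\<omega>. (step (Suc k) \<omega> - c)\<^sup>2)"
      using int Y_sq_int step_shift_sq(1)[of "Suc k"] by simp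
    also have "\<dots> \<le> B2 * k + 0 + B2"
    proof (intro add_mono Suc.IH step_shift_sq(2))
      have "0 \<le> (1 - p) / k * expectation (\<lambda>\<omega>. (Y k \<omega>)\<^sup>2)"
        using p_le_1 by (intro mult_nonneg_nonneg Bochner_Integration.integral_nonneg) auto
      then show "2 * expectation (\<lambda>\<omega>. Y k \<omega> * (step (Suc k) \<omega> - c)) \<le> 0"
        unfolding drift by simp
    qed simp
    finally show ?thesis by (simp add: algebra_simps)
  qed
qed

lemma Y_abs: "integrable M (\<lambda>\<omega>. \<bar>Y k \<omega>\<bar>)" "expectation (\<lambda>\<omega>. \<bar>Y k \<omega>\<bar>) \<le> sqrt (B2 * k)"
  using Y_int expectation_abs_le_sqrt[OF Y_measurable Y_sq_int, of k] Y_second_moment[of k]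
  by (auto intro: order_trans real_sqrt_le_mono)

section \<open>Weak law of large numbers for the squared steps\<close>

text \<open>An even function of a step is a positively reinforced quantity, so the correlations add up,
  but with exponent \<open>2 - p < 2\<close> in the second moment.\<close>

lemma even_sum_second_moment:
  fixes h :: "real \<Rightarrow> real"
  defines "W \<equiv> \<lambda>k \<omega>. \<Sum>j=1..k. h (step j \<omega>) - expectation (\<lambda>\<omega>. h (X 1 \<omega>))"
  assumes h [measurable]: "h \<in> borel_measurable borel" and even: "\<And>x. h (- x) = h x"
    and bound: "\<And>x. 0 \<le> h x" "\<And>x. h x \<le> B" and k: "1 \<le> k"
  shows "W k \<in> borel_measurable M" "integrable M (\<lambda>\<omega>. (W k \<omega>)\<^sup>2)"
    and "expectation (\<lambda>\<omega>. (W k \<omega>)\<^sup>2) \<le> B\<^sup>2 / p * real k powr (2 - p)"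
proof -
  define m where "m = expectation (\<lambda>\<omega>. h (X 1 \<omega>))"
  define g where "g x = h x - m" for x
  have W: "W = (\<lambda>k \<omega>. \<Sum>j=1..k. g (step j \<omega>))"
    by (simp add: W_def g_def m_def)
  have [measurable]: "X 1 \<in> borel_measurable M" by simp
  have [measurable]: "g \<in> borel_measurable borel" unfolding g_def[abs_def] by measurable
  have g_even: "g (- x) = g x" for x by (simp add: g_def even)
  have int_h: "integrable M (\<lambda>\<omega>. h (X 1 \<omega>))"
    using bound by (intro integrable_const_bound[of _ B]) auto
  have m: "0 \<le> m" "m \<le> B"
    unfolding m_def using bound int_h
    by (auto intro: Bochner_Integration.integral_nonneg integral_le_const)
  have g_bound: "\<bar>g x\<bar> \<le> B" for x
    unfolding g_def using bound[of x] m by linarith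
  have int_g: "integrable M (\<lambda>\<omega>. g (X 1 \<omega>))" and E_g: "expectation (\<lambda>\<omega>. g (X 1 \<omega>)) = 0"
    using int_h by (simp_all add: g_def m_def prob_space)
  have W_meas [measurable]: "W k \<in> borel_measurable M" for k
    unfolding W by (rule sum_step_measurable) measurable
  have W_bound: "\<bar>W k \<omega>\<bar> \<le> B * k" for k \<omega>
  proof -
    have "\<bar>W k \<omega>\<bar> \<le> (\<Sum>j=1..k. \<bar>g (step j \<omega>)\<bar>)" unfolding W by (rule sum_abs)
    also have "\<dots> \<le> (\<Sum>j=1..k. B)" by (intro sum_mono g_bound)
    finally show ?thesis by (simp add: mult.commute)
  qed
  have int_bounded: "integrable M f" if [measurable]: "f \<in> borel_measurable M" and "\<And>\<omega>. \<bar>f \<omega>\<bar> \<le> C"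
    for f :: "'a \<Rightarrow> real" and C
    using that(2) by (intro integrable_const_bound[of _ C]) auto
  have step_meas: "step j \<in> borel_measurable M" if "1 \<le> j" for j
    using that by (rule step_measurable)
  have int_W: "integrable M (W k)" for k
    by (rule int_bounded[OF W_meas W_bound])
  have int_Wg: "integrable M (\<lambda>\<omega>. W k \<omega> * g (step j \<omega>))" if "1 \<le> j" for j k
  proof (rule int_bounded)
    note step_meas[OF that, measurable]
    show "(\<lambda>\<omega>. W k \<omega> * g (step j \<omega>)) \<in> borel_measurable M" by measurable
    show "\<bar>W k \<omega> * g (step j \<omega>)\<bar> \<le> B * k * B" for \<omega>
      unfolding abs_mult using W_bound[of k \<omega>] g_bound m by (intro mult_mono) auto
  qed
  have int_W2: "integrable M (\<lambda>\<omega>. (W k \<omega>)\<^sup>2)" for k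
  proof (rule int_bounded)
    show "\<bar>(W k \<omega>)\<^sup>2\<bar> \<le> (B * k)\<^sup>2" for \<omega>
      using power_mono[OF W_bound[of k \<omega>], of 2] by simp
  qed measurable
  have g2: "integrable M (\<lambda>\<omega>. (g (step j \<omega>))\<^sup>2)" "expectation (\<lambda>\<omega>. (g (step j \<omega>))\<^sup>2) \<le> B\<^sup>2"
    if "1 \<le> j" for j
  proof -
    note step_meas[OF that, measurable]
    have *: "(g (step j \<omega>))\<^sup>2 \<le> B\<^sup>2" for \<omega>
      using power_mono[OF g_bound[of "step j \<omega>"], of 2] by simp
    show "integrable M (\<lambda>\<omega>. (g (step j \<omega>))\<^sup>2)"
      by (rule int_bounded[of _ "B\<^sup>2"]) (use * in auto)
    then show "expectation (\<lambda>\<omega>. (g (step j \<omega>))\<^sup>2) \<le> B\<^sup>2"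
      using * by (intro integral_le_const) auto
  qed
  \<comment> \<open>Since \<open>g\<close> is even, a copy contributes \<open>W k / k\<close> on
    average with a positive sign. The cross term is now nonnegative, in contrast to the one for
    \<open>Y\<close>.\<close>
  have rec: "expectation (\<lambda>\<omega>. (W (Suc k) \<omega>)\<^sup>2) \<le>
      (1 + 2 * (1 - p) / k) * expectation (\<lambda>\<omega>. (W k \<omega>)\<^sup>2) + B\<^sup>2" if k: "1 \<le> k" for k
  proof -
    have "expectation (\<lambda>\<omega>. W k \<omega> * g (step (Suc k) \<omega>)) =
        of_real p * expectation (W k) * expectation (\<lambda>\<omega>. g (X 1 \<omega>)) +
        of_real ((1 - p) / k) * (\<Sum>j=1..k. expectation (\<lambda>\<omega>. W k \<omega> * g (- step j \<omega>)))"
    proof (unfold W, rule step_expectation(2)[of "\<lambda>x. x" g g, OF _ _ _ k _ int_g])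
      show "integrable M (\<lambda>\<omega>. \<Sum>j=1..k. g (step j \<omega>))" using int_W[of k] by (simp add: W)
      show "integrable M (\<lambda>\<omega>. (\<Sum>j=1..k. g (step j \<omega>)) * g (- step j \<omega>))" if "j \<in> {1..k}" for j
        using int_Wg[of j k] that by (simp add: W g_even)
    qed measurable
    also have "(\<Sum>j=1..k. expectation (\<lambda>\<omega>. W k \<omega> * g (- step j \<omega>))) =
        expectation (\<lambda>\<omega>. \<Sum>j=1..k. W k \<omega> * g (step j \<omega>))"
      unfolding g_even by (rule Bochner_Integration.integral_sum[symmetric]) (use int_Wg in auto)
    also have "(\<lambda>\<omega>. \<Sum>j=1..k. W k \<omega> * g (step j \<omega>)) = (\<lambda>\<omega>. (W k \<omega>)\<^sup>2)"
      unfolding sum_distrib_left[symmetric] by (simp add: W power2_eq_square)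
    finally have cross: "expectation (\<lambda>\<omega>. W k \<omega> * g (step (Suc k) \<omega>)) =
        (1 - p) / k * expectation (\<lambda>\<omega>. (W k \<omega>)\<^sup>2)"
      unfolding E_g by simp
    have "(\<lambda>\<omega>. (W (Suc k) \<omega>)\<^sup>2) =
        (\<lambda>\<omega>. (W k \<omega>)\<^sup>2 + 2 * (W k \<omega> * g (step (Suc k) \<omega>)) + (g (step (Suc k) \<omega>))\<^sup>2)"
      by (rule ext) (simp add: W power2_sum)
    then have "expectation (\<lambda>\<omega>. (W (Suc k) \<omega>)\<^sup>2) = expectation (\<lambda>\<omega>. (W k \<omega>)\<^sup>2) +
        2 * expectation (\<lambda>\<omega>. W k \<omega> * g (step (Suc k) \<omega>)) + expectation (\<lambda>\<omega>. (g (step (Suc k) \<omega>))\<^sup>2)"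
      using int_W2 int_Wg[of "Suc k" k] g2(1)[of "Suc k"] by simp
    also have "\<dots> \<le> expectation (\<lambda>\<omega>. (W k \<omega>)\<^sup>2) +
        2 * ((1 - p) / k * expectation (\<lambda>\<omega>. (W k \<omega>)\<^sup>2)) + B\<^sup>2"
      unfolding cross using g2(2)[of "Suc k"] by simp
    finally show ?thesis by (simp add: algebra_simps)
  qed
  show "W k \<in> borel_measurable M" "integrable M (\<lambda>\<omega>. (W k \<omega>)\<^sup>2)"
    by (rule W_meas, rule int_W2)
  show "expectation (\<lambda>\<omega>. (W k \<omega>)\<^sup>2) \<le> B\<^sup>2 / p * real k powr (2 - p)"
    using k
  proof (induction k rule: nat_induct_at_least)
    case base
    have "expectation (\<lambda>\<omega>. (W 1 \<omega>)\<^sup>2) \<le> B\<^sup>2" using g2(2)[of 1] by (simp add: W)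
    also have "\<dots> \<le> B\<^sup>2 / p" using p_pos p_le_1 by (simp add: pos_le_divide_eq mult_left_le)
    finally show ?case by simp
  next
    case (Suc k)
    \<comment> \<open>The constant is chosen so that \<open>A * p\<close> absorbs the additive
      \<open>B\<^sup>2\<close>; then \<open>2 * (1 - p) + p = 2 - p\<close> is exactly the factor
      that \<open>powr_Suc_ge\<close> supplies for the exponent \<open>2 - p\<close>.\<close>
    define A where "A = B\<^sup>2 / p"
    have A: "0 \<le> A" "B\<^sup>2 = A * p" using p_pos by (auto simp: A_def)
    have k: "0 < real k" using Suc.hyps by simp
    have pow: "real k powr (2 - p) = real k * real k powr (1 - p)"
      using k by (simp add: powr_mult_base)
    have "expectation (\<lambda>\<omega>. (W (Suc k) \<omega>)\<^sup>2) \<le>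
        (1 + 2 * (1 - p) / k) * (A * real k powr (2 - p)) + B\<^sup>2"
      using rec[OF Suc.hyps] Suc.IH p_le_1 k unfolding A_def
      by (elim order_trans) (intro add_right_mono mult_left_mono; simp)
    also have "(1 + 2 * (1 - p) / k) * (A * real k powr (2 - p)) =
        A * real k powr (2 - p) + 2 * (1 - p) * A * real k powr (1 - p)"
      unfolding pow using k by (simp add: field_simps)
    also have "A * real k powr (2 - p) + 2 * (1 - p) * A * real k powr (1 - p) + B\<^sup>2 \<le>
        A * real k powr (2 - p) + 2 * (1 - p) * A * real k powr (1 - p) + A * p * real k powr (1 - p)"
    proof -
      have "1 \<le> real k powr (1 - p)" using Suc.hyps p_le_1 by (intro ge_one_powr_ge_zero) auto
      then show ?thesis unfolding A(2) using A p_pos mult_left_mono[of 1 "real k powr (1 - p)" "A * p"] by simp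
    qed
    also have "\<dots> = A * (real k powr (2 - p) + (2 - p) * real k powr (2 - p - 1))"
      by (simp add: algebra_simps)
    also have "\<dots> \<le> A * real (Suc k) powr (2 - p)"
      using A Suc.hyps p_le_1 by (intro mult_left_mono powr_Suc_ge) auto
    finally show ?case unfolding A_def .
  qed
qed

lemma truncated_square_expectation:
  "(\<lambda>K. expectation (\<lambda>\<omega>. min ((X 1 \<omega>)\<^sup>2) (real K))) \<longlonglongrightarrow> m2"
  unfolding m2_def
proof (rule integral_dominated_convergence[where w = "\<lambda>\<omega>. (X 1 \<omega>)\<^sup>2"])
  show "AE \<omega> in M. (\<lambda>K. min ((X 1 \<omega>)\<^sup>2) (real K)) \<longlonglongrightarrow> (X 1 \<omega>)\<^sup>2"
  proof (rule AE_I2)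
    fix \<omega>
    obtain N :: nat where N: "(X 1 \<omega>)\<^sup>2 \<le> N" using real_arch_simple by blast
    have "eventually (\<lambda>K. min ((X 1 \<omega>)\<^sup>2) (real K) = (X 1 \<omega>)\<^sup>2) sequentially"
      using eventually_ge_at_top[of N] by eventually_elim (use N in auto)
    then show "(\<lambda>K. min ((X 1 \<omega>)\<^sup>2) (real K)) \<longlonglongrightarrow> (X 1 \<omega>)\<^sup>2"
      by (rule tendsto_eventually)
  qed
qed (use X_sq in auto)

text \<open>The square is truncated at a level \<open>K\<close>. The truncated sum
  \<open>W k\<close>, divided by \<open>k\<close>, has L1 norm of order
  \<open>k powr (- p / 2)\<close> by the variance bound. The discarded part is nonnegative with mean
  \<open>m2 - m\<close> at every step, hence small uniformly in \<open>k\<close>.\<close>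

lemma V_LLN: "(\<lambda>k. expectation (\<lambda>\<omega>. \<bar>V k \<omega> / k - m2\<bar>)) \<longlonglongrightarrow> 0"
proof (rule LIMSEQ_I)
  fix e :: real assume e: "0 < e"
  \<comment> \<open>The truncation error enters twice, as the mean of the discarded part and as
    \<open>m - m2\<close>, hence the quarter.\<close>
  obtain K :: nat where K: "\<bar>expectation (\<lambda>\<omega>. min ((X 1 \<omega>)\<^sup>2) (real K)) - m2\<bar> < e / 4"
    using LIMSEQ_D[OF truncated_square_expectation, of "e / 4"] e by auto
  define h where "h x = min (x\<^sup>2) (real K)" for x :: real
  define m where "m = expectation (\<lambda>\<omega>. h (X 1 \<omega>))"
  define W where "W k \<omega> = (\<Sum>j=1..k. h (step j \<omega>) - m)" for k \<omega>
  have [measurable]: "h \<in> borel_measurable borel" unfolding h_def[abs_def] by measurable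
  have h: "\<And>x. h (- x) = h x" "\<And>x. 0 \<le> h x" "\<And>x. h x \<le> K" by (auto simp: h_def)
  note W2 = even_sum_second_moment[of h K, folded m_def, folded W_def, OF _ h]
  have [measurable]: "X 1 \<in> borel_measurable M" by simp
  have int_h: "integrable M (\<lambda>\<omega>. h (X 1 \<omega>))"
    using h by (intro integrable_const_bound[of _ K]) auto
  have m: "\<bar>m - m2\<bar> < e / 4" using K by (simp add: m_def h_def)
  define R where "R j \<omega> = (step j \<omega>)\<^sup>2 - h (step j \<omega>)" for j \<omega>
  have R_nonneg: "0 \<le> R j \<omega>" for j \<omega> by (simp add: R_def h_def)
  have R: "integrable M (R j)" "expectation (R j) = m2 - m" if "1 \<le> j" for j
    using even_step[of h j, OF _ h(1) int_h that] step_sq[OF that]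
    by (simp_all add: R_def[abs_def] m_def)
  have bound: "expectation (\<lambda>\<omega>. \<bar>V k \<omega> / k - m2\<bar>) \<le> sqrt ((real K)\<^sup>2 / p * real k powr (- p)) + e / 2"
    if k: "1 \<le> k" for k
  proof -
    have int_W: "integrable M (\<lambda>\<omega>. \<bar>W k \<omega>\<bar>)"
      using integrable_power2_imp[OF W2(1,2)[OF _ k]] by simp
    have int_R: "integrable M (\<lambda>\<omega>. \<Sum>j=1..k. R j \<omega>)"
      using R by (intro Bochner_Integration.integrable_sum) auto
    have eq: "V k \<omega> / k - m2 = (W k \<omega> + (\<Sum>j=1..k. R j \<omega>)) / k + (m - m2)" for \<omega>
    proof -
      have "V k \<omega> = W k \<omega> + (\<Sum>j=1..k. R j \<omega>) + k * m"
        by (simp add: V_def W_def R_def sum_subtractf)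
      then show ?thesis using k by (simp add: field_simps)
    qed
    have "expectation (\<lambda>\<omega>. \<bar>V k \<omega> / k - m2\<bar>) \<le>
        expectation (\<lambda>\<omega>. (\<bar>W k \<omega>\<bar> + (\<Sum>j=1..k. R j \<omega>)) / k + \<bar>m - m2\<bar>)"
    proof (rule integral_mono')
      show "integrable M (\<lambda>\<omega>. (\<bar>W k \<omega>\<bar> + (\<Sum>j=1..k. R j \<omega>)) / k + \<bar>m - m2\<bar>)"
        using int_W int_R by simp
      show "\<bar>V k \<omega> / k - m2\<bar> \<le> (\<bar>W k \<omega>\<bar> + (\<Sum>j=1..k. R j \<omega>)) / k + \<bar>m - m2\<bar>" for \<omega>
      proof -
        have "0 \<le> (\<Sum>j=1..k. R j \<omega>)" by (intro sum_nonneg R_nonneg)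
        then have "\<bar>(W k \<omega> + (\<Sum>j=1..k. R j \<omega>)) / k\<bar> \<le> (\<bar>W k \<omega>\<bar> + (\<Sum>j=1..k. R j \<omega>)) / k"
          by (simp add: abs_divide divide_right_mono)
        then show ?thesis unfolding eq by linarith
      qed
    qed (use R_nonneg in \<open>auto intro!: add_nonneg_nonneg divide_nonneg_nonneg sum_nonneg\<close>)
    also have "\<dots> = (expectation (\<lambda>\<omega>. \<bar>W k \<omega>\<bar>) + expectation (\<lambda>\<omega>. \<Sum>j=1..k. R j \<omega>)) / k + \<bar>m - m2\<bar>"
      using int_W int_R by (simp add: prob_space)
    also have "expectation (\<lambda>\<omega>. \<Sum>j=1..k. R j \<omega>) = (\<Sum>j=1..k. expectation (R j))"
      using R by (intro Bochner_Integration.integral_sum) auto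
    also have "\<dots> = k * (m2 - m)" using R by simp
    also have "(expectation (\<lambda>\<omega>. \<bar>W k \<omega>\<bar>) + k * (m2 - m)) / k =
        expectation (\<lambda>\<omega>. \<bar>W k \<omega>\<bar>) / k + (m2 - m)"
      using k by (simp add: field_simps)
    also have "expectation (\<lambda>\<omega>. \<bar>W k \<omega>\<bar>) / k \<le> sqrt ((real K)\<^sup>2 / p * real k powr (- p))"
    proof -
      have "expectation (\<lambda>\<omega>. \<bar>W k \<omega>\<bar>) \<le> sqrt (expectation (\<lambda>\<omega>. (W k \<omega>)\<^sup>2))"
        by (rule expectation_abs_le_sqrt[OF W2(1,2)[OF _ k]]) simp_all
      also have "\<dots> \<le> sqrt ((real K)\<^sup>2 / p * real k powr (2 - p))"
        by (intro real_sqrt_le_mono W2(3)[OF _ k]) simp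
      also have "(real K)\<^sup>2 / p * real k powr (2 - p) = (real K)\<^sup>2 / p * real k powr (- p) * (real k)\<^sup>2"
        using k by (simp add: powr_diff powr_minus powr_numeral field_simps)
      also have "sqrt \<dots> = sqrt ((real K)\<^sup>2 / p * real k powr (- p)) * k"
        by (simp only: real_sqrt_mult real_sqrt_abs abs_of_nat)
      finally show ?thesis using k by (simp add: field_simps)
    qed
    finally show ?thesis using m by linarith
  qed
  have "(\<lambda>k. sqrt ((real K)\<^sup>2 / p * real k powr (- p))) \<longlonglongrightarrow> sqrt ((real K)\<^sup>2 / p * 0)"
    using p_pos by (intro tendsto_intros tendsto_neg_powr filterlim_real_sequentially) auto
  then have "(\<lambda>k. sqrt ((real K)\<^sup>2 / p * real k powr (- p))) \<longlonglongrightarrow> 0" by simp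
  from LIMSEQ_D[OF this, of "e / 2"] e obtain N
    where N: "\<And>k. N \<le> k \<Longrightarrow> \<bar>sqrt ((real K)\<^sup>2 / p * real k powr (- p))\<bar> < e / 2" by auto
  show "\<exists>no. \<forall>k\<ge>no. norm (expectation (\<lambda>\<omega>. \<bar>V k \<omega> / k - m2\<bar>) - 0) < e"
  proof (intro exI allI impI)
    fix k assume k: "max 1 N \<le> k"
    have "0 \<le> expectation (\<lambda>\<omega>. \<bar>V k \<omega> / k - m2\<bar>)" by (rule Bochner_Integration.integral_nonneg) simp
    then show "norm (expectation (\<lambda>\<omega>. \<bar>V k \<omega> / k - m2\<bar>) - 0) < e"
      using bound[of k] N[of k] k by auto
  qed
qed

subsection \<open>Recursion for the characteristic functions\<close>


definition sg2 where "sg2 = m2 - c\<^sup>2"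
definition tau where "tau = sg2 / (3 - 2 * p)"

lemma sg2_nonneg: "0 \<le> sg2"
proof -
  have "variance (X 1) = m2 - m1\<^sup>2"
    unfolding m1_def m2_def by (rule variance_eq[OF X_int X_sq])
  then have "m1\<^sup>2 \<le> m2" using variance_positive[of "X 1"] by simp
  moreover have "c\<^sup>2 \<le> m1\<^sup>2"
  proof -
    have "p / (2 - p) \<le> 1" "0 \<le> p / (2 - p)" using p_pos p_le_1 by auto
    then have "(p / (2 - p))\<^sup>2 \<le> 1" by (rule power_le_one[rotated])
    then show ?thesis
      unfolding c_def power_mult_distrib by (intro mult_left_le_one_le) auto
  qed
  ultimately show ?thesis by (simp add: sg2_def)
qed

lemma tau_nonneg: "0 \<le> tau"
  using sg2_nonneg p_le_1 by (simp add: tau_def)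

lemma sg2_eq: "sg2 = (3 - 2 * p) * tau"
  using p_le_1 by (simp add: tau_def)

definition \<phi> where "\<phi> k t = (CLINT \<omega>|M. iexp (t * Y k \<omega>))"
definition \<gamma> where "\<gamma> k t = exp (- (t\<^sup>2 * (real k * tau)) / 2)" for t :: real

text \<open>Envelope, after division by \<open>t\<^sup>2\<close>, of the second order Taylor
  remainder at frequencies up to \<open>T\<close>. It is even in \<open>x\<close>, so its mean is
  the same at every step, and it is dominated by an integrable square.\<close>

definition rem where "rem T x = min ((\<bar>x\<bar> + \<bar>c\<bar>)\<^sup>2) (T * (\<bar>x\<bar> + \<bar>c\<bar>) ^ 3)" for T x :: real
definition rho where "rho T = expectation (\<lambda>\<omega>. rem T (X 1 \<omega>))"
text \<open>L1 error in replacing the conditional second moment of an increment by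
  \<open>sg2\<close>: the weak law accounts for the first term, the bound on \<open>Y k / k\<close>
  for the second.\<close>

definition delta where
  "delta k = expectation (\<lambda>\<omega>. \<bar>V k \<omega> / k - m2\<bar>) + 2 * \<bar>c\<bar> * sqrt (B2 / k)" for k :: nat

lemma integrable_unimodular_mult:
  fixes Z :: "'a \<Rightarrow> complex" and f :: "'a \<Rightarrow> real"
  assumes [measurable]: "Z \<in> borel_measurable M" and Z: "\<And>\<omega>. cmod (Z \<omega>) \<le> 1"
    and f: "integrable M f"
  shows "integrable M (\<lambda>\<omega>. Z \<omega> * of_real (f \<omega>))"
    and "cmod (\<integral>\<omega>. Z \<omega> * of_real (f \<omega>) \<partial>M) \<le> expectation (\<lambda>\<omega>. \<bar>f \<omega>\<bar>)"
proof -
  note borel_measurable_integrable[OF f, measurable]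
  have le: "cmod (Z \<omega> * of_real (f \<omega>)) \<le> \<bar>f \<omega>\<bar>" for \<omega>
    using mult_right_mono[OF Z[of \<omega>], of "\<bar>f \<omega>\<bar>"] by (simp add: norm_mult)
  show int: "integrable M (\<lambda>\<omega>. Z \<omega> * of_real (f \<omega>))"
    by (rule Bochner_Integration.integrable_bound[OF f]) (use le in auto)
  have "cmod (\<integral>\<omega>. Z \<omega> * of_real (f \<omega>) \<partial>M) \<le> expectation (\<lambda>\<omega>. cmod (Z \<omega> * of_real (f \<omega>)))"
    by (rule integral_norm_bound)
  also have "\<dots> \<le> expectation (\<lambda>\<omega>. \<bar>f \<omega>\<bar>)"
    using int f le by (intro Bochner_Integration.integral_mono) auto
  finally show "cmod (\<integral>\<omega>. Z \<omega> * of_real (f \<omega>) \<partial>M) \<le> expectation (\<lambda>\<omega>. \<bar>f \<omega>\<bar>)" .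
qed

lemma rho_tendsto:
  assumes "T \<longlonglongrightarrow> 0" and T: "\<And>n. 0 \<le> T n"
  shows "(\<lambda>n. rho (T n)) \<longlonglongrightarrow> 0"
proof -
  have [measurable]: "X 1 \<in> borel_measurable M" by simp
  have "(\<lambda>n. expectation (\<lambda>\<omega>. rem (T n) (X 1 \<omega>))) \<longlonglongrightarrow> expectation (\<lambda>\<omega>. 0)"
  proof (rule integral_dominated_convergence[OF _ _ X_B2_int])
    show "AE \<omega> in M. (\<lambda>n. rem (T n) (X 1 \<omega>)) \<longlonglongrightarrow> 0"
    proof (rule AE_I2)
      fix \<omega>
      have "(\<lambda>n. rem (T n) (X 1 \<omega>)) \<longlonglongrightarrow> min ((\<bar>X 1 \<omega>\<bar> + \<bar>c\<bar>)\<^sup>2) (0 * (\<bar>X 1 \<omega>\<bar> + \<bar>c\<bar>) ^ 3)"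
        unfolding rem_def using assms(1) by (intro tendsto_intros)
      then show "(\<lambda>n. rem (T n) (X 1 \<omega>)) \<longlonglongrightarrow> 0" by simp
    qed
    show "AE \<omega> in M. norm (rem (T n) (X 1 \<omega>)) \<le> (\<bar>X 1 \<omega>\<bar> + \<bar>c\<bar>)\<^sup>2" for n
      using T[of n] by (auto simp: rem_def min_def)
    show "(\<lambda>\<omega>. rem (T n) (X 1 \<omega>)) \<in> borel_measurable M" for n
      unfolding rem_def by measurable
  qed simp
  then show ?thesis by (simp add: rho_def)
qed

lemma rho_step:
  assumes "0 \<le> T" "1 \<le> k"
  shows "integrable M (\<lambda>\<omega>. rem T (step k \<omega>))" "expectation (\<lambda>\<omega>. rem T (step k \<omega>)) = rho T"
proof -
  have [measurable]: "rem T \<in> borel_measurable borel" unfolding rem_def[abs_def] by measurable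
  have [measurable]: "X 1 \<in> borel_measurable M" by simp
  have "integrable M (\<lambda>\<omega>. rem T (X 1 \<omega>))"
    by (rule Bochner_Integration.integrable_bound[OF X_B2_int]) (use assms in \<open>auto simp: rem_def min_def\<close>)
  note * = even_step[of "rem T", OF _ _ this assms(2)]
  show "integrable M (\<lambda>\<omega>. rem T (step k \<omega>))" by (rule *) (simp_all add: rem_def)
  show "expectation (\<lambda>\<omega>. rem T (step k \<omega>)) = rho T"
    unfolding rho_def by (rule *) (simp_all add: rem_def)
qed

lemma iexp_remainder:
  assumes "\<bar>t\<bar> \<le> T"
  shows "cmod (iexp (t * (x - c)) - 1 - \<i> * of_real (t * (x - c)) + of_real ((t * (x - c))\<^sup>2) / 2)
    \<le> t\<^sup>2 * rem T x"
proof -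
  have a: "\<bar>x - c\<bar> \<le> \<bar>x\<bar> + \<bar>c\<bar>" by simp
  have "(t * (x - c))\<^sup>2 \<le> t\<^sup>2 * (\<bar>x\<bar> + \<bar>c\<bar>)\<^sup>2"
    using power_mono[OF a, of 2] by (simp add: power_mult_distrib mult_left_mono)
  moreover have "\<bar>t * (x - c)\<bar> ^ 3 \<le> t\<^sup>2 * (T * (\<bar>x\<bar> + \<bar>c\<bar>) ^ 3)"
  proof -
    have "\<bar>t * (x - c)\<bar> ^ 3 = t\<^sup>2 * (\<bar>t\<bar> * \<bar>x - c\<bar> ^ 3)"
      by (subst power2_abs[of t, symmetric])
        (simp only: abs_mult power_mult_distrib power3_eq_cube power2_eq_square mult_ac)
    also have "\<dots> \<le> t\<^sup>2 * (T * (\<bar>x\<bar> + \<bar>c\<bar>) ^ 3)"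
      using assms by (intro mult_left_mono mult_mono power_mono a) auto
    finally show ?thesis .
  qed
  ultimately have "min ((t * (x - c))\<^sup>2) (\<bar>t * (x - c)\<bar> ^ 3) \<le> t\<^sup>2 * rem T x"
    unfolding rem_def min_mult_distrib_left by auto
  then show ?thesis by (rule order_trans[OF iexp_second_order])
qed

lemma Y_abs_div: "1 \<le> k \<Longrightarrow> expectation (\<lambda>\<omega>. \<bar>Y k \<omega>\<bar>) / k \<le> sqrt (B2 / k)"
proof -
  assume k: "1 \<le> k"
  have "sqrt (B2 * k) = sqrt (B2 / k * (real k)\<^sup>2)"
    using k by (simp add: power2_eq_square)
  also have "\<dots> = sqrt (B2 / k) * k"
    by (simp only: real_sqrt_mult real_sqrt_abs abs_of_nat)
  finally show ?thesis using Y_abs(2)[of k] k by (simp add: field_simps)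
qed

text \<open>A copied increment has square \<open>(- x - c)\<^sup>2 = x\<^sup>2 + 2 * c * (x - c) + 3
  * c\<^sup>2\<close>, whose average over the past is \<open>m2 + 3 * c\<^sup>2\<close> up to the
  error \<open>D\<close>. Mixed with the innovation term \<open>m2 - 2 * c * m1 + c\<^sup>2\<close>,
  the main part becomes \<open>sg2\<close> by \<open>c_eq\<close>.\<close>

lemma quadratic_term:
  assumes k: "1 \<le> k"
  shows "integrable M (\<lambda>\<omega>. iexp (t * Y k \<omega>) * of_real ((step (Suc k) \<omega> - c)\<^sup>2))"
    and "cmod ((CLINT \<omega>|M. iexp (t * Y k \<omega>) * of_real ((step (Suc k) \<omega> - c)\<^sup>2)) - sg2 * \<phi> k t)
      \<le> delta k"
proof -
  define Z where "Z \<omega> = iexp (t * Y k \<omega>)" for \<omega>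
  have [measurable]: "Z \<in> borel_measurable M" unfolding Z_def[abs_def] by measurable
  have Z1: "cmod (Z \<omega>) \<le> 1" for \<omega> by (simp add: Z_def)
  note Zf = integrable_unimodular_mult[of Z, OF _ Z1]
  have int_Z: "integrable M Z"
    using Zf(1)[of "\<lambda>_. 1"] by simp
  have sq: "integrable M (\<lambda>\<omega>. (step j \<omega> + a)\<^sup>2)" if "1 \<le> j" for j a
    by (rule sq_shift_int[OF step_measurable[OF that] step_sq(1)[OF that]])
  have X_sq_shift: "integrable M (\<lambda>\<omega>. (X 1 \<omega> - c)\<^sup>2)"
    using sq_shift_int[of "X 1" "- c"] X_sq by simp
  have E_X: "expectation (\<lambda>\<omega>. (X 1 \<omega> - c)\<^sup>2) = m2 - 2 * c * m1 + c\<^sup>2"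
  proof -
    have "(\<lambda>\<omega>. (X 1 \<omega> - c)\<^sup>2) = (\<lambda>\<omega>. (X 1 \<omega>)\<^sup>2 - 2 * c * X 1 \<omega> + c\<^sup>2)"
      by (rule ext) (simp add: power2_diff)
    then show ?thesis
      unfolding m1_def m2_def using X_sq X_int by (simp add: prob_space)
  qed
  have neg_sq: "(- step j \<omega> - c)\<^sup>2 = (step j \<omega> + c)\<^sup>2" for j \<omega>
    by (simp add: power2_eq_square algebra_simps)
  have int_Zj: "integrable M (\<lambda>\<omega>. Z \<omega> * of_real ((- step j \<omega> - c)\<^sup>2))" if "j \<in> {1..k}" for j
    unfolding neg_sq by (intro Zf sq) (use that in auto)
  note * = step_expectation[of "\<lambda>y. iexp (t * y)" "\<lambda>x. of_real ((x - c)\<^sup>2)" "\<lambda>x. x - c", OF _ _ _ k,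
    folded Y_def, folded Z_def, OF _ _ _ int_Z _ int_Zj]
  have int_GX: "integrable M (\<lambda>\<omega>. complex_of_real ((X 1 \<omega> - c)\<^sup>2))"
    using X_sq_shift by (rule integrable_of_real)
  show "integrable M (\<lambda>\<omega>. iexp (t * Y k \<omega>) * of_real ((step (Suc k) \<omega> - c)\<^sup>2))"
    using *(1)[OF _ _ _ int_GX] by (simp add: Z_def)
  let ?Q = "CLINT \<omega>|M. iexp (t * Y k \<omega>) * of_real ((step (Suc k) \<omega> - c)\<^sup>2)"
  define D where "D \<omega> = (V k \<omega> / k - m2) + 2 * c * (Y k \<omega> / k)" for \<omega>
  have int_V: "integrable M (V k)"
    unfolding V_def[abs_def] using step_sq(1) by (intro Bochner_Integration.integrable_sum) auto
  have int_D: "integrable M D"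
    unfolding D_def[abs_def] using int_V Y_int by simp
  have sum_eq: "(\<Sum>j=1..k. (- step j \<omega> - c)\<^sup>2) = k * (D \<omega> + (m2 + 3 * c\<^sup>2))" for \<omega>
  proof -
    have "(\<Sum>j=1..k. (- step j \<omega> - c)\<^sup>2) = (\<Sum>j=1..k. (step j \<omega>)\<^sup>2 + 2 * c * (step j \<omega> - c) + 3 * c\<^sup>2)"
      by (intro sum.cong) (simp_all add: power2_eq_square algebra_simps)
    also have "\<dots> = V k \<omega> + 2 * c * Y k \<omega> + k * (3 * c\<^sup>2)"
      by (simp only: sum.distrib sum_distrib_left[symmetric] V_def Y_def) simp
    also have "\<dots> = k * (D \<omega> + (m2 + 3 * c\<^sup>2))"
      using k by (simp add: D_def field_simps)
    finally show ?thesis .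
  qed
  have "(\<Sum>j=1..k. CLINT \<omega>|M. Z \<omega> * of_real ((- step j \<omega> - c)\<^sup>2)) =
      (CLINT \<omega>|M. \<Sum>j=1..k. Z \<omega> * of_real ((- step j \<omega> - c)\<^sup>2))"
    by (rule Bochner_Integration.integral_sum[symmetric]) (rule int_Zj)
  also have "(\<lambda>\<omega>. \<Sum>j=1..k. Z \<omega> * of_real ((- step j \<omega> - c)\<^sup>2)) =
      (\<lambda>\<omega>. of_nat k * (Z \<omega> * of_real (D \<omega>)) + of_real (k * (m2 + 3 * c\<^sup>2)) * Z \<omega>)"
  proof
    fix \<omega>
    have "(\<Sum>j=1..k. Z \<omega> * of_real ((- step j \<omega> - c)\<^sup>2)) = Z \<omega> * of_real (\<Sum>j=1..k. (- step j \<omega> - c)\<^sup>2)"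
      by (simp only: sum_distrib_left of_real_sum)
    then show "(\<Sum>j=1..k. Z \<omega> * of_real ((- step j \<omega> - c)\<^sup>2)) =
        of_nat k * (Z \<omega> * of_real (D \<omega>)) + of_real (k * (m2 + 3 * c\<^sup>2)) * Z \<omega>"
      unfolding sum_eq by (simp add: algebra_simps)
  qed
  also have "(CLINT \<omega>|M. of_nat k * (Z \<omega> * of_real (D \<omega>)) + of_real (k * (m2 + 3 * c\<^sup>2)) * Z \<omega>) =
      of_nat k * (CLINT \<omega>|M. Z \<omega> * of_real (D \<omega>)) + of_real (k * (m2 + 3 * c\<^sup>2)) * integral\<^sup>L M Z"
    using Zf(1)[OF _ int_D] int_Z by simp
  finally have sum_E: "(\<Sum>j=1..k. CLINT \<omega>|M. Z \<omega> * of_real ((- step j \<omega> - c)\<^sup>2)) =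
      of_nat k * (CLINT \<omega>|M. Z \<omega> * of_real (D \<omega>)) + of_real (k * (m2 + 3 * c\<^sup>2)) * integral\<^sup>L M Z" .
  have E_GX: "(CLINT \<omega>|M. complex_of_real ((X 1 \<omega> - c)\<^sup>2)) = of_real (m2 - 2 * c * m1 + c\<^sup>2)"
    unfolding E_X[symmetric] by (rule integral_complex_of_real)
  have "?Q = of_real p * integral\<^sup>L M Z * of_real (m2 - 2 * c * m1 + c\<^sup>2) +
      of_real ((1 - p) / k) * (of_nat k * (CLINT \<omega>|M. Z \<omega> * of_real (D \<omega>)) +
        of_real (k * (m2 + 3 * c\<^sup>2)) * integral\<^sup>L M Z)"
    unfolding sum_E[symmetric] E_GX[symmetric] Z_def[symmetric]
    by (rule *(2)[OF _ _ _ int_GX]) simp_all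
  also have "\<dots> = of_real (p * (m2 - 2 * c * m1 + c\<^sup>2) + (1 - p) * (m2 + 3 * c\<^sup>2)) * integral\<^sup>L M Z +
      of_real (1 - p) * (CLINT \<omega>|M. Z \<omega> * of_real (D \<omega>))"
    using k by (simp add: field_simps)
  also have "p * (m2 - 2 * c * m1 + c\<^sup>2) + (1 - p) * (m2 + 3 * c\<^sup>2) = sg2"
  proof -
    have "p * (m2 - 2 * c * m1 + c\<^sup>2) + (1 - p) * (m2 + 3 * c\<^sup>2) =
        m2 - 2 * c * (p * m1) + p * c\<^sup>2 + (1 - p) * (3 * c\<^sup>2)" by (simp add: algebra_simps)
    then show ?thesis unfolding c_eq sg2_def by (simp add: algebra_simps power2_eq_square)
  qed
  finally have "?Q - sg2 * \<phi> k t = of_real (1 - p) * (CLINT \<omega>|M. Z \<omega> * of_real (D \<omega>))"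
    by (simp add: \<phi>_def Z_def[abs_def])
  then have "cmod (?Q - sg2 * \<phi> k t) = (1 - p) * cmod (CLINT \<omega>|M. Z \<omega> * of_real (D \<omega>))"
    using p_le_1 by (simp only: norm_mult norm_of_real)
  also have "\<dots> \<le> 1 * expectation (\<lambda>\<omega>. \<bar>D \<omega>\<bar>)"
    using p_le_1 p_pos by (intro mult_mono Zf int_D) auto
  also have "expectation (\<lambda>\<omega>. \<bar>D \<omega>\<bar>) \<le>
      expectation (\<lambda>\<omega>. \<bar>V k \<omega> / k - m2\<bar> + 2 * \<bar>c\<bar> * (\<bar>Y k \<omega>\<bar> / k))"
    unfolding D_def using int_D int_V Y_int
    by (intro Bochner_Integration.integral_mono)
      (auto simp: D_def[abs_def] abs_mult intro!: order_trans[OF abs_triangle_ineq])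
  also have "\<dots> = expectation (\<lambda>\<omega>. \<bar>V k \<omega> / k - m2\<bar>) + 2 * \<bar>c\<bar> * (expectation (\<lambda>\<omega>. \<bar>Y k \<omega>\<bar>) / k)"
    using int_V Y_int by simp
  also have "\<dots> \<le> delta k"
    unfolding delta_def using Y_abs_div[OF k] by (intro add_left_mono mult_left_mono) auto
  finally show "cmod (?Q - sg2 * \<phi> k t) \<le> delta k" by simp
qed

text \<open>The error of one step of both recursions, divided by \<open>t\<^sup>2\<close>, is split
  in two: \<open>eta\<close> vanishes as time grows, \<open>zeta\<close> vanishes with the frequency
  range \<open>T\<close>.\<close>

definition eta where "eta k = B2 / k + delta k + tau / k" for k :: nat
definition zeta where "zeta T = rho T + sg2 * T * sqrt B2 + T\<^sup>2 * sg2\<^sup>2" for T :: real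

text \<open>The first order term of the expansion, an integral of \<open>Y k\<close> against the
  exponential, is not small. It agrees with the first order term of \<open>\<phi> k\<close> at the
  contracted frequency, so it cancels and never has to be estimated.\<close>

lemma \<phi>_step:
  assumes k: "1 \<le> k" and t: "\<bar>t\<bar> \<le> T"
  shows "cmod (\<phi> (Suc k) t - \<phi> k ((1 - (1 - p) / k) * t) * of_real (1 - t\<^sup>2 * sg2 / 2))
    \<le> t\<^sup>2 * (rho T + B2 / k + delta k + sg2 * T * sqrt B2)"
proof -
  define q where "q = (1 - p) / k"
  \<comment> \<open>The shift of frequency: \<open>(1 - q) * t = t + s\<close>.\<close>
  define s where "s = - (t * q)"
  define Z where "Z \<omega> = iexp (t * Y k \<omega>)" for \<omega>
  define \<xi> where "\<xi> \<omega> = step (Suc k) \<omega> - c" for \<omega>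
  have q: "0 \<le> q" "q \<le> 1 / k" "q \<le> 1"
    using p_le_1 p_pos k by (auto simp: q_def divide_le_eq intro: divide_right_mono)
  have [measurable]: "Z \<in> borel_measurable M" unfolding Z_def[abs_def] by measurable
  have step_meas: "step j \<in> borel_measurable M" if "1 \<le> j" for j using that by (rule step_measurable)
  note step_meas[of "Suc k", simplified, measurable]
  have [measurable]: "\<xi> \<in> borel_measurable M" unfolding \<xi>_def[abs_def] by measurable
  have Z1: "cmod (Z \<omega>) \<le> 1" for \<omega> by (simp add: Z_def)
  note Zf = integrable_unimodular_mult[of Z, OF _ Z1]
  have int_Z: "integrable M Z" using Zf(1)[of "\<lambda>_. 1"] by simp
  have E_Z: "integral\<^sup>L M Z = \<phi> k t" by (simp add: \<phi>_def Z_def[abs_def])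
  have int_ZY: "integrable M (\<lambda>\<omega>. Z \<omega> * of_real (Y k \<omega>))" using Zf Y_int by simp
  have int_Zstep: "integrable M (\<lambda>\<omega>. Z \<omega> * of_real (step j \<omega>))" if "j \<in> {1..k}" for j
    using Zf(1)[of "step j"] step_int[of j] that by simp
  note drift = expectation_drift[of "\<lambda>y. iexp (t * y)" k, OF _ k, folded Z_def, OF _ int_Z int_Zstep,
      folded q_def \<xi>_def]
  have int_Z\<xi>: "integrable M (\<lambda>\<omega>. Z \<omega> * of_real (\<xi> \<omega>))"
    and E_Z\<xi>: "(CLINT \<omega>|M. Z \<omega> * of_real (\<xi> \<omega>)) = - of_real q * (CLINT \<omega>|M. Z \<omega> * of_real (Y k \<omega>))"
    by (rule drift; simp)+
  note quad = quadratic_term[OF k, of t, folded Z_def \<xi>_def]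

  \<comment> \<open>Three remainders: \<open>e1\<close> of second order in the new increment,
    \<open>e2\<close> of first order in the frequency shift, and \<open>e3\<close> of order zero in
    that shift. The last suffices where a factor \<open>t\<^sup>2\<close> is already
    present.\<close>
  define e1 where "e1 \<omega> = Z \<omega> * (iexp (t * \<xi> \<omega>) - 1 - \<i> * of_real (t * \<xi> \<omega>) + of_real ((t * \<xi> \<omega>)\<^sup>2) / 2)" for \<omega>
  define e2 where "e2 \<omega> = Z \<omega> * (iexp (s * Y k \<omega>) - 1 - \<i> * of_real (s * Y k \<omega>))" for \<omega>
  define e3 where "e3 \<omega> = Z \<omega> * (iexp (s * Y k \<omega>) - 1)" for \<omega>
  have [measurable]: "e1 \<in> borel_measurable M" "e2 \<in> borel_measurable M" "e3 \<in> borel_measurable M"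
    unfolding e1_def[abs_def] e2_def[abs_def] e3_def[abs_def] by measurable
  have bounded: "integrable M e" "cmod (integral\<^sup>L M e) \<le> expectation r"
    if [measurable]: "e \<in> borel_measurable M" and "integrable M r" and "\<And>\<omega>. cmod (e \<omega>) \<le> r \<omega>"
    for e :: "'a \<Rightarrow> complex" and r
  proof -
    have r: "\<bar>r \<omega>\<bar> = r \<omega>" for \<omega> using that(3)[of \<omega>] norm_ge_zero[of "e \<omega>"] by linarith
    show int: "integrable M e"
      by (rule Bochner_Integration.integrable_bound[OF that(2)]) (use that(3) r in auto)
    have "cmod (integral\<^sup>L M e) \<le> expectation (\<lambda>\<omega>. cmod (e \<omega>))" by (rule integral_norm_bound)
    also have "\<dots> \<le> expectation r"
      using int that by (intro Bochner_Integration.integral_mono) auto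
    finally show "cmod (integral\<^sup>L M e) \<le> expectation r" .
  qed
  have T: "0 \<le> T" using t by linarith
  have Z_norm: "cmod (Z \<omega>) = 1" for \<omega> by (simp add: Z_def)
  have E1: "integrable M e1" "cmod (integral\<^sup>L M e1) \<le> t\<^sup>2 * rho T"
  proof -
    have "cmod (e1 \<omega>) \<le> t\<^sup>2 * rem T (step (Suc k) \<omega>)" for \<omega>
      unfolding e1_def norm_mult Z_norm mult_1 \<xi>_def by (rule iexp_remainder[OF t])
    note * = bounded[of e1 "\<lambda>\<omega>. t\<^sup>2 * rem T (step (Suc k) \<omega>)", OF _ _ this]
    show "integrable M e1" "cmod (integral\<^sup>L M e1) \<le> t\<^sup>2 * rho T"
      using * rho_step[OF T, of "Suc k"] by simp_all
  qed
  have s: "s\<^sup>2 * k \<le> t\<^sup>2 / k" "\<bar>s\<bar> \<le> \<bar>t\<bar> / k"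
  proof -
    have "\<bar>s\<bar> = \<bar>t\<bar> * q" using q by (simp add: s_def abs_mult)
    also have "\<dots> \<le> \<bar>t\<bar> * (1 / k)" by (intro mult_left_mono q) simp
    finally show le: "\<bar>s\<bar> \<le> \<bar>t\<bar> / k" by simp
    have "s\<^sup>2 \<le> t\<^sup>2 / (real k)\<^sup>2" using power_mono[OF le, of 2] by (simp add: power_divide)
    then have "s\<^sup>2 * k \<le> t\<^sup>2 / (real k)\<^sup>2 * k" by (rule mult_right_mono) simp
    then show "s\<^sup>2 * k \<le> t\<^sup>2 / k" using k by (simp add: power2_eq_square)
  qed
  have E2: "integrable M e2" "cmod (integral\<^sup>L M e2) \<le> t\<^sup>2 * (B2 / k)"
  proof -
    have "cmod (e2 \<omega>) \<le> (s * Y k \<omega>)\<^sup>2 / 2" for \<omega>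
      unfolding e2_def norm_mult Z_norm mult_1 by (rule iexp_first_order)
    then have "cmod (e2 \<omega>) \<le> s\<^sup>2 * (Y k \<omega>)\<^sup>2" for \<omega>
      by (rule order_trans) (simp add: power_mult_distrib)
    note * = bounded[of e2 "\<lambda>\<omega>. s\<^sup>2 * (Y k \<omega>)\<^sup>2", OF _ _ this]
    show "integrable M e2" using * Y_sq_int by simp
    have "cmod (integral\<^sup>L M e2) \<le> s\<^sup>2 * expectation (\<lambda>\<omega>. (Y k \<omega>)\<^sup>2)" using * Y_sq_int by simp
    also have "\<dots> \<le> s\<^sup>2 * (B2 * k)" by (intro mult_left_mono Y_second_moment) simp
    also have "\<dots> = B2 * (s\<^sup>2 * k)" by simp
    also have "\<dots> \<le> B2 * (t\<^sup>2 / k)" by (intro mult_left_mono s B2_nonneg)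
    finally show "cmod (integral\<^sup>L M e2) \<le> t\<^sup>2 * (B2 / k)" by (simp add: mult.commute)
  qed
  have E3: "integrable M e3" "cmod (integral\<^sup>L M e3) \<le> T * sqrt B2"
  proof -
    have "cmod (e3 \<omega>) \<le> \<bar>s * Y k \<omega>\<bar>" for \<omega>
      unfolding e3_def norm_mult Z_norm mult_1 by (rule iexp_minus_1_le)
    then have "cmod (e3 \<omega>) \<le> \<bar>s\<bar> * \<bar>Y k \<omega>\<bar>" for \<omega> by (simp add: abs_mult)
    note * = bounded[of e3 "\<lambda>\<omega>. \<bar>s\<bar> * \<bar>Y k \<omega>\<bar>", OF _ _ this]
    show "integrable M e3" using * Y_int by simp
    have "cmod (integral\<^sup>L M e3) \<le> \<bar>s\<bar> * expectation (\<lambda>\<omega>. \<bar>Y k \<omega>\<bar>)" using * Y_int by simp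
    also have "\<dots> \<le> \<bar>t\<bar> / k * expectation (\<lambda>\<omega>. \<bar>Y k \<omega>\<bar>)"
      by (intro mult_right_mono s Bochner_Integration.integral_nonneg) simp
    also have "\<dots> = \<bar>t\<bar> * (expectation (\<lambda>\<omega>. \<bar>Y k \<omega>\<bar>) / k)" by simp
    also have "\<dots> \<le> T * sqrt B2"
    proof (intro mult_mono t T)
      have "B2 / k \<le> B2 / 1" using k B2_nonneg by (intro divide_left_mono) auto
      then show "expectation (\<lambda>\<omega>. \<bar>Y k \<omega>\<bar>) / k \<le> sqrt B2"
        using order_trans[OF Y_abs_div[OF k] real_sqrt_le_mono[of "B2 / k" B2]] by simp
    qed (auto intro!: divide_nonneg_nonneg Bochner_Integration.integral_nonneg)
    finally show "cmod (integral\<^sup>L M e3) \<le> T * sqrt B2" .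
  qed
  define A where "A = (CLINT \<omega>|M. Z \<omega> * of_real (Y k \<omega>))"
  define Q where "Q = (CLINT \<omega>|M. Z \<omega> * of_real ((\<xi> \<omega>)\<^sup>2))"
  have \<phi>_Suc: "\<phi> (Suc k) t = \<phi> k t - \<i> * of_real (t * q) * A - of_real (t\<^sup>2 / 2) * Q + integral\<^sup>L M e1"
  proof -
    have "iexp (t * Y (Suc k) \<omega>) = Z \<omega> + \<i> * of_real t * (Z \<omega> * of_real (\<xi> \<omega>))
        - of_real (t\<^sup>2 / 2) * (Z \<omega> * of_real ((\<xi> \<omega>)\<^sup>2)) + e1 \<omega>" for \<omega>
    proof -
      have "Y (Suc k) \<omega> = Y k \<omega> + \<xi> \<omega>" by (simp add: Y_def \<xi>_def)
      then have "iexp (t * Y (Suc k) \<omega>) = Z \<omega> * iexp (t * \<xi> \<omega>)"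
        by (simp add: Z_def distrib_left exp_add)
      then show ?thesis
        by (simp add: e1_def power_mult_distrib algebra_simps)
    qed
    then have "\<phi> (Suc k) t = (CLINT \<omega>|M. Z \<omega> + \<i> * of_real t * (Z \<omega> * of_real (\<xi> \<omega>))
        - of_real (t\<^sup>2 / 2) * (Z \<omega> * of_real ((\<xi> \<omega>)\<^sup>2)) + e1 \<omega>)"
      by (simp only: \<phi>_def)
    also have "\<dots> = integral\<^sup>L M Z + \<i> * of_real t * (CLINT \<omega>|M. Z \<omega> * of_real (\<xi> \<omega>))
        - of_real (t\<^sup>2 / 2) * Q + integral\<^sup>L M e1"
      unfolding Q_def using int_Z int_Z\<xi> quad(1) E1(1)
      by (simp del: of_real_power of_real_divide)
    finally show ?thesis
      unfolding E_Z E_Z\<xi> A_def by simp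
  qed
  have \<phi>_a2: "\<phi> k ((1 - q) * t) = \<phi> k t - \<i> * of_real (t * q) * A + integral\<^sup>L M e2"
    and \<phi>_a3: "\<phi> k ((1 - q) * t) = \<phi> k t + integral\<^sup>L M e3"
  proof -
    have eq: "iexp ((1 - q) * t * Y k \<omega>) = Z \<omega> * iexp (s * Y k \<omega>)" for \<omega>
      by (simp add: Z_def s_def algebra_simps flip: exp_add)
    have "iexp ((1 - q) * t * Y k \<omega>) = Z \<omega> + \<i> * of_real s * (Z \<omega> * of_real (Y k \<omega>)) + e2 \<omega>" for \<omega>
      unfolding eq by (simp add: e2_def algebra_simps)
    then have "\<phi> k ((1 - q) * t) = (CLINT \<omega>|M. Z \<omega> + \<i> * of_real s * (Z \<omega> * of_real (Y k \<omega>)) + e2 \<omega>)"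
      by (simp only: \<phi>_def)
    also have "\<dots> = \<phi> k t + \<i> * of_real s * A + integral\<^sup>L M e2"
      unfolding E_Z[symmetric] A_def using int_Z int_ZY E2(1) by simp
    finally show "\<phi> k ((1 - q) * t) = \<phi> k t - \<i> * of_real (t * q) * A + integral\<^sup>L M e2"
      by (simp add: s_def)
    have "iexp ((1 - q) * t * Y k \<omega>) = Z \<omega> + e3 \<omega>" for \<omega>
      unfolding eq by (simp add: e3_def algebra_simps)
    then have "\<phi> k ((1 - q) * t) = (CLINT \<omega>|M. Z \<omega> + e3 \<omega>)"
      by (simp only: \<phi>_def)
    then show "\<phi> k ((1 - q) * t) = \<phi> k t + integral\<^sup>L M e3"
      unfolding E_Z[symmetric] using int_Z E3(1) by simp
  qed
  \<comment> \<open>The terms with \<open>A\<close> cancel between the two expansions. The remainder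
    \<open>e3\<close> appears because \<open>sg2\<close> multiplies \<open>\<phi> k\<close> at the
    contracted frequency here, and at \<open>t\<close> in \<open>quad\<close>.\<close>
  have "\<phi> (Suc k) t - \<phi> k ((1 - q) * t) * of_real (1 - t\<^sup>2 * sg2 / 2) =
      integral\<^sup>L M e1 - integral\<^sup>L M e2 - of_real (t\<^sup>2 / 2) * (Q - sg2 * \<phi> k t)
      + of_real (t\<^sup>2 * sg2 / 2) * integral\<^sup>L M e3"
  proof -
    define F where "F = \<phi> k ((1 - q) * t)"
    have "\<phi> (Suc k) t = F - integral\<^sup>L M e2 - of_real (t\<^sup>2 / 2) * Q + integral\<^sup>L M e1"
      unfolding F_def \<phi>_Suc \<phi>_a2 by simp
    moreover have "integral\<^sup>L M e3 = F - \<phi> k t" unfolding F_def \<phi>_a3 by simp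
    ultimately show ?thesis unfolding F_def[symmetric] by (simp only:) (simp add: field_simps)
  qed
  then have "cmod (\<phi> (Suc k) t - \<phi> k ((1 - q) * t) * of_real (1 - t\<^sup>2 * sg2 / 2)) \<le>
      cmod (integral\<^sup>L M e1) + cmod (integral\<^sup>L M e2) + cmod (of_real (t\<^sup>2 / 2) * (Q - sg2 * \<phi> k t))
      + cmod (of_real (t\<^sup>2 * sg2 / 2) * integral\<^sup>L M e3)"
    by (auto intro!: norm_triangle_mono norm_triangle_le norm_triangle_le_diff)
  also have "\<dots> \<le> t\<^sup>2 * rho T + t\<^sup>2 * (B2 / k) + t\<^sup>2 * delta k + t\<^sup>2 * (sg2 * (T * sqrt B2))"
  proof (intro add_mono E1 E2)
    have "cmod (of_real (t\<^sup>2 / 2) * (Q - sg2 * \<phi> k t)) = t\<^sup>2 / 2 * cmod (Q - sg2 * \<phi> k t)"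
      by (simp only: norm_mult norm_of_real) simp
    also have "\<dots> \<le> t\<^sup>2 * delta k"
      unfolding Q_def by (intro mult_mono quad(2)) auto
    finally show "cmod (of_real (t\<^sup>2 / 2) * (Q - sg2 * \<phi> k t)) \<le> t\<^sup>2 * delta k" .
    have "cmod (of_real (t\<^sup>2 * sg2 / 2) * integral\<^sup>L M e3) = t\<^sup>2 * sg2 / 2 * cmod (integral\<^sup>L M e3)"
      using sg2_nonneg by (simp only: norm_mult norm_of_real) simp
    also have "\<dots> \<le> t\<^sup>2 * sg2 * (T * sqrt B2)"
      using sg2_nonneg by (intro mult_mono E3(2)) auto
    finally show "cmod (of_real (t\<^sup>2 * sg2 / 2) * integral\<^sup>L M e3) \<le> t\<^sup>2 * (sg2 * (T * sqrt B2))"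
      by simp
  qed
  finally show ?thesis unfolding q_def by (simp add: algebra_simps)
qed

text \<open>\<open>(k + 1) - k (1 - (1 - p) / k)\<^sup>2 = 3 - 2 p + O(1 / k)\<close> is where the denominator of the variance
  comes from.\<close>

lemma \<gamma>_step:
  assumes k: "1 \<le> k" and t: "\<bar>t\<bar> \<le> T"
  shows "\<bar>\<gamma> (Suc k) t - \<gamma> k ((1 - (1 - p) / k) * t) * (1 - t\<^sup>2 * sg2 / 2)\<bar>
    \<le> t\<^sup>2 * (tau / k + T\<^sup>2 * sg2\<^sup>2)"
proof -
  define x where "x = t\<^sup>2 * sg2 / 2"
  \<comment> \<open>The part of the exponent that is quadratic in \<open>(1 - p) / k\<close>.
    Passing to \<open>Suc k\<close> multiplies by \<open>exp (- (x - y))\<close>, so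
    \<open>y\<close> is the defect of order \<open>1 / k\<close>.\<close>
  define y where "y = t\<^sup>2 * tau * (1 - p)\<^sup>2 / (2 * k)"
  have k0: "0 < real k" "1 \<le> real k" using k by auto
  have p2: "(1 - p)\<^sup>2 \<le> 1" "0 \<le> 1 - p" using p_pos p_le_1 by (auto simp: power_le_one)
  have x: "0 \<le> x" using sg2_nonneg by (simp add: x_def)
  have y: "0 \<le> y" using tau_nonneg by (simp add: y_def)
  have y_le: "y \<le> t\<^sup>2 * tau / (2 * k)"
    unfolding y_def using tau_nonneg p2 by (intro divide_right_mono mult_right_le_one_le) auto
  \<comment> \<open>Ensures that \<open>x - y\<close> is a legitimate argument of
    \<open>exp_minus_first_order\<close>; it rests on \<open>3 - 2 * p \<ge> 1\<close>.\<close>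
  have y_le_x: "y \<le> x"
  proof -
    have "t\<^sup>2 * tau / (2 * k) \<le> t\<^sup>2 * tau / 2"
      using k0 tau_nonneg by (intro divide_left_mono) auto
    also have "\<dots> \<le> t\<^sup>2 * sg2 / 2"
    proof -
      have "1 * tau \<le> sg2"
        unfolding sg2_eq using tau_nonneg p_le_1 by (intro mult_right_mono) auto
      then show ?thesis by (intro divide_right_mono mult_left_mono) auto
    qed
    finally show ?thesis using y_le by (simp add: x_def)
  qed
  have "\<gamma> (Suc k) t = \<gamma> k ((1 - (1 - p) / k) * t) * exp (- (x - y))"
  proof -
    have "(1 - (1 - p) / k)\<^sup>2 * k = k - 2 * (1 - p) + (1 - p)\<^sup>2 / k"
      using k0 by (simp add: power2_eq_square field_simps)
    then have "((1 - (1 - p) / k) * t)\<^sup>2 * (k * tau) = t\<^sup>2 * tau * (k - 2 * (1 - p) + (1 - p)\<^sup>2 / k)"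
      by (simp add: power_mult_distrib mult_ac)
    then have "- (t\<^sup>2 * (real (Suc k) * tau)) / 2 =
        - (((1 - (1 - p) / k) * t)\<^sup>2 * (k * tau)) / 2 + - (x - y)"
      unfolding x_def y_def sg2_eq using k0 by (simp add: field_simps)
    then show ?thesis unfolding \<gamma>_def by (simp only: exp_add)
  qed
  then have "\<gamma> (Suc k) t - \<gamma> k ((1 - (1 - p) / k) * t) * (1 - x) =
      \<gamma> k ((1 - (1 - p) / k) * t) * ((exp (- (x - y)) - 1 + (x - y)) + y)"
    by (simp add: algebra_simps)
  then have "\<bar>\<gamma> (Suc k) t - \<gamma> k ((1 - (1 - p) / k) * t) * (1 - x)\<bar> =
      \<gamma> k ((1 - (1 - p) / k) * t) * \<bar>(exp (- (x - y)) - 1 + (x - y)) + y\<bar>"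
    by (simp add: abs_mult \<gamma>_def)
  also have "\<dots> \<le> 1 * \<bar>(exp (- (x - y)) - 1 + (x - y)) + y\<bar>"
    using tau_nonneg by (intro mult_right_mono) (auto simp: \<gamma>_def)
  also have "\<dots> \<le> (x - y)\<^sup>2 + y"
    using exp_minus_first_order[of "x - y"] y_le_x y by simp
  also have "\<dots> \<le> x\<^sup>2 + t\<^sup>2 * tau / (2 * k)"
    using y y_le_x by (intro add_mono y_le power_mono) auto
  also have "\<dots> \<le> t\<^sup>2 * (T\<^sup>2 * sg2\<^sup>2) + t\<^sup>2 * (tau / k)"
  proof (rule add_mono)
    have "t\<^sup>2 \<le> T\<^sup>2" using power_mono[OF t, of 2] by simp
    then have "t\<^sup>2 * (t\<^sup>2 * sg2\<^sup>2) \<le> t\<^sup>2 * (T\<^sup>2 * sg2\<^sup>2)"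
      by (intro mult_left_mono mult_right_mono) auto
    moreover have "t\<^sup>2 * (t\<^sup>2 * sg2\<^sup>2) / 4 \<le> t\<^sup>2 * (t\<^sup>2 * sg2\<^sup>2)" by simp
    ultimately have "t\<^sup>2 * (t\<^sup>2 * sg2\<^sup>2) / 4 \<le> t\<^sup>2 * (T\<^sup>2 * sg2\<^sup>2)" by linarith
    then show "x\<^sup>2 \<le> t\<^sup>2 * (T\<^sup>2 * sg2\<^sup>2)" by (simp add: x_def power2_eq_square mult_ac)
    show "t\<^sup>2 * tau / (2 * k) \<le> t\<^sup>2 * (tau / k)"
      using k0 tau_nonneg by (simp add: field_simps)
  qed
  finally show ?thesis unfolding x_def by (simp add: algebra_simps)
qed

text \<open>The recursion changes the frequency, so the induction runs over all \<open>t\<close> in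
  the range at once. The bound on \<open>T\<close> puts the multiplier \<open>w\<close> into
  \<open>[0, 1]\<close>, so the inherited error does not grow and each step adds at most
  \<open>T\<^sup>2 * (eta k + zeta T)\<close>.\<close>

lemma \<phi>_\<gamma>_diff:
  assumes T: "T\<^sup>2 * sg2 \<le> 2" and "1 \<le> k" "\<bar>t\<bar> \<le> T"
  shows "cmod (\<phi> k t - \<gamma> k t) \<le> T * sqrt B2 + T\<^sup>2 * tau + T\<^sup>2 * (\<Sum>j=1..<k. eta j + zeta T)"
  using assms(2,3)
proof (induction k arbitrary: t rule: nat_induct_at_least)
  case base
  have "cmod (\<phi> 1 t - 1) \<le> T * sqrt B2"
  proof -
    have int: "integrable M (\<lambda>\<omega>. iexp (t * Y 1 \<omega>))"
      using integrable_unimodular_mult(1)[of "\<lambda>\<omega>. iexp (t * Y 1 \<omega>)" "\<lambda>_. 1"] by simp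
    then have "\<phi> 1 t - 1 = (CLINT \<omega>|M. iexp (t * Y 1 \<omega>) - 1)"
      by (simp add: \<phi>_def prob_space)
    also have "cmod \<dots> \<le> expectation (\<lambda>\<omega>. cmod (iexp (t * Y 1 \<omega>) - 1))"
      by (rule integral_norm_bound)
    also have "\<dots> \<le> expectation (\<lambda>\<omega>. \<bar>t\<bar> * \<bar>Y 1 \<omega>\<bar>)"
      using int Y_int iexp_minus_1_le[of "t * Y 1 _"]
      by (intro Bochner_Integration.integral_mono) (auto simp: abs_mult)
    also have "\<dots> = \<bar>t\<bar> * expectation (\<lambda>\<omega>. \<bar>Y 1 \<omega>\<bar>)" by simp
    also have "\<dots> \<le> T * sqrt B2"
      using Y_abs(2)[of 1] base by (intro mult_mono) auto
    finally show ?thesis .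
  qed
  moreover have "cmod (1 - of_real (\<gamma> 1 t)) \<le> T\<^sup>2 * tau"
  proof -
    have "1 - \<gamma> 1 t \<le> t\<^sup>2 * tau / 2"
      unfolding \<gamma>_def using exp_ge_add_one_self[of "- (t\<^sup>2 * (real 1 * tau)) / 2"] by simp
    also have "\<dots> \<le> T\<^sup>2 * tau"
    proof -
      have "t\<^sup>2 * tau \<le> T\<^sup>2 * tau"
        using power_mono[OF base, of 2] tau_nonneg by (intro mult_right_mono) auto
      moreover have "0 \<le> t\<^sup>2 * tau" using tau_nonneg by simp
      ultimately show ?thesis by linarith
    qed
    finally have "1 - \<gamma> 1 t \<le> T\<^sup>2 * tau" .
    moreover have "\<gamma> 1 t \<le> 1" using tau_nonneg by (simp add: \<gamma>_def)
    ultimately have "\<bar>1 - \<gamma> 1 t\<bar> \<le> T\<^sup>2 * tau" by simp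
    then show ?thesis by (metis norm_of_real of_real_1 of_real_diff)
  qed
  ultimately have "cmod ((\<phi> 1 t - 1) + (1 - of_real (\<gamma> 1 t))) \<le> T * sqrt B2 + T\<^sup>2 * tau"
    by (rule norm_triangle_mono)
  then show ?case by simp
next
  case (Suc k)
  define a where "a = 1 - (1 - p) / k"
  define w where "w = 1 - t\<^sup>2 * sg2 / 2"
  have "(1 - p) / k \<le> 1 / 1"
    using p_pos p_le_1 Suc.hyps by (intro frac_le) auto
  then have a: "0 \<le> a" "a \<le> 1" using p_le_1 by (auto simp: a_def)
  have "\<bar>a * t\<bar> \<le> 1 * \<bar>t\<bar>"
    unfolding abs_mult using a by (intro mult_right_mono) auto
  then have at: "\<bar>a * t\<bar> \<le> T" using Suc.prems by simp
  have t2: "t\<^sup>2 \<le> T\<^sup>2" using power_mono[OF Suc.prems, of 2] by simp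
  have w: "\<bar>w\<bar> \<le> 1"
  proof -
    have "t\<^sup>2 * sg2 \<le> T\<^sup>2 * sg2" by (intro mult_right_mono t2 sg2_nonneg)
    moreover have "0 \<le> t\<^sup>2 * sg2" using sg2_nonneg by simp
    ultimately show ?thesis using T unfolding w_def by (simp add: abs_le_iff)
  qed
  have T0: "0 \<le> T" using Suc.prems by linarith
  have *: "t\<^sup>2 * r \<le> T\<^sup>2 * r" if "0 \<le> r" for r using that by (intro mult_right_mono t2)
  have \<phi>: "cmod (\<phi> (Suc k) t - \<phi> k (a * t) * of_real w) \<le> t\<^sup>2 * (rho T + B2 / k + delta k + sg2 * T * sqrt B2)"
    unfolding a_def w_def by (rule \<phi>_step[OF Suc.hyps Suc.prems])
  have \<gamma>: "cmod (of_real (\<gamma> (Suc k) t) - of_real (\<gamma> k (a * t)) * of_real w) \<le> t\<^sup>2 * (tau / k + T\<^sup>2 * sg2\<^sup>2)"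
    using \<gamma>_step[OF Suc.hyps Suc.prems] unfolding a_def w_def
    by (metis norm_of_real of_real_diff of_real_mult)
  have main: "cmod ((\<phi> k (a * t) - \<gamma> k (a * t)) * of_real w) \<le>
      T * sqrt B2 + T\<^sup>2 * tau + T\<^sup>2 * (\<Sum>j=1..<k. eta j + zeta T)"
  proof -
    have "cmod ((\<phi> k (a * t) - \<gamma> k (a * t)) * of_real w) \<le> cmod (\<phi> k (a * t) - \<gamma> k (a * t)) * 1"
      unfolding norm_mult norm_of_real by (intro mult_left_mono w) simp
    then show ?thesis using Suc.IH[OF at] by simp
  qed
  have "\<phi> (Suc k) t - \<gamma> (Suc k) t =
      (\<phi> k (a * t) - \<gamma> k (a * t)) * of_real w + (\<phi> (Suc k) t - \<phi> k (a * t) * of_real w)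
      - (of_real (\<gamma> (Suc k) t) - of_real (\<gamma> k (a * t)) * of_real w)"
    by (simp add: algebra_simps)
  then have "cmod (\<phi> (Suc k) t - \<gamma> (Suc k) t) \<le>
      cmod ((\<phi> k (a * t) - \<gamma> k (a * t)) * of_real w) + cmod (\<phi> (Suc k) t - \<phi> k (a * t) * of_real w)
      + cmod (of_real (\<gamma> (Suc k) t) - of_real (\<gamma> k (a * t)) * of_real w)"
    by (simp only:) (intro norm_triangle_le_diff add_right_mono norm_triangle_ineq)
  also have "\<dots> \<le> (T * sqrt B2 + T\<^sup>2 * tau + T\<^sup>2 * (\<Sum>j=1..<k. eta j + zeta T)) +
      t\<^sup>2 * (rho T + B2 / k + delta k + sg2 * T * sqrt B2) + t\<^sup>2 * (tau / k + T\<^sup>2 * sg2\<^sup>2)"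
    by (intro add_mono main \<phi> \<gamma>)
  also have "\<dots> = T * sqrt B2 + T\<^sup>2 * tau + T\<^sup>2 * (\<Sum>j=1..<k. eta j + zeta T) + t\<^sup>2 * (eta k + zeta T)"
    by (simp add: eta_def zeta_def algebra_simps)
  also have "\<dots> \<le> T * sqrt B2 + T\<^sup>2 * tau + T\<^sup>2 * (\<Sum>j=1..<k. eta j + zeta T) + T\<^sup>2 * (eta k + zeta T)"
  proof -
    have "0 \<le> rho T"
      unfolding rho_def using T0 by (intro Bochner_Integration.integral_nonneg) (simp add: rem_def)
    then have "0 \<le> zeta T"
      unfolding zeta_def using T0 sg2_nonneg B2_nonneg by simp
    moreover have "0 \<le> eta k"
      unfolding eta_def delta_def using B2_nonneg tau_nonneg
      by (intro add_nonneg_nonneg Bochner_Integration.integral_nonneg) auto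
    ultimately show ?thesis by (intro add_left_mono *) simp
  qed
  also have "\<dots> = T * sqrt B2 + T\<^sup>2 * tau + T\<^sup>2 * (\<Sum>j=1..<Suc k. eta j + zeta T)"
    using Suc.hyps by (simp add: algebra_simps)
  finally show ?case .
qed

section \<open>Passage to the limit\<close>

lemma eta_tendsto: "eta \<longlonglongrightarrow> 0"
proof -
  have inv: "(\<lambda>k. r / real k) \<longlonglongrightarrow> 0" for r :: real
    by (rule tendsto_divide_0[OF tendsto_const]) (rule filterlim_real_at_infinity_sequentially)
  have "(\<lambda>k. B2 / k + (expectation (\<lambda>\<omega>. \<bar>V k \<omega> / k - m2\<bar>) + 2 * \<bar>c\<bar> * sqrt (B2 / k)) + tau / k)
      \<longlonglongrightarrow> 0 + (0 + 2 * \<bar>c\<bar> * sqrt 0) + 0"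
    by (intro tendsto_intros inv V_LLN)
  then show ?thesis by (simp add: eta_def[abs_def] delta_def)
qed

lemma \<phi>_scaled_tendsto: "(\<lambda>n. \<phi> n (s / sqrt n)) \<longlonglongrightarrow> of_real (exp (- (s\<^sup>2 * tau) / 2))"
proof -
  define T where "T n = \<bar>s\<bar> / sqrt n" for n :: nat
  have T0: "0 \<le> T n" for n by (simp add: T_def)
  have T_lim: "T \<longlonglongrightarrow> 0"
    unfolding T_def
    by (intro tendsto_divide_0[OF tendsto_const] filterlim_at_top_imp_at_infinity
        filterlim_compose[OF sqrt_at_top] filterlim_real_sequentially)
  have T2_lim: "(\<lambda>n. (T n)\<^sup>2 * sg2) \<longlonglongrightarrow> 0\<^sup>2 * sg2" by (intro tendsto_intros T_lim)
  have zeta_lim: "(\<lambda>n. zeta (T n)) \<longlonglongrightarrow> 0 + sg2 * 0 * sqrt B2 + 0\<^sup>2 * sg2\<^sup>2"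
    unfolding zeta_def by (intro tendsto_intros T_lim rho_tendsto T0)
  \<comment> \<open>As \<open>T n\<close> has square \<open>s\<^sup>2 / n\<close>, the sum of
    \<open>eta\<close> becomes a Cesaro mean, and the \<open>n - 1\<close> copies of
    \<open>zeta (T n)\<close> cost at most
    \<open>s\<^sup>2 * \<bar>zeta (T n)\<bar>\<close>.\<close>
  define b where "b n = T n * sqrt B2 + (T n)\<^sup>2 * tau + s\<^sup>2 * ((\<Sum>j=1..<n. eta j) / n) + s\<^sup>2 * \<bar>zeta (T n)\<bar>" for n
  have "b \<longlonglongrightarrow> 0 * sqrt B2 + 0\<^sup>2 * tau + s\<^sup>2 * 0 + s\<^sup>2 * \<bar>0\<bar>"
    unfolding b_def using zeta_lim by (intro tendsto_intros T_lim cesaro_null eta_tendsto) simp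
  then have b_lim: "b \<longlonglongrightarrow> 0" by simp
  have "eventually (\<lambda>n. (T n)\<^sup>2 * sg2 < 2) sequentially"
    using T2_lim by (rule order_tendstoD) simp
  then have "eventually (\<lambda>n. cmod (\<phi> n (s / sqrt n) - of_real (exp (- (s\<^sup>2 * tau) / 2))) \<le> b n) sequentially"
    using eventually_ge_at_top[of 1]
  proof eventually_elim
    case (elim n)
    have Tn: "(T n)\<^sup>2 = s\<^sup>2 / n" by (simp add: T_def power_divide)
    \<comment> \<open>At this frequency the comparison function does not depend on \<open>n\<close>:
      it is already the limit.\<close>
    have \<gamma>: "\<gamma> n (s / sqrt n) = exp (- (s\<^sup>2 * tau) / 2)"
      using elim by (simp add: \<gamma>_def power_divide)
    have "cmod (\<phi> n (s / sqrt n) - \<gamma> n (s / sqrt n)) \<le>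
        T n * sqrt B2 + (T n)\<^sup>2 * tau + (T n)\<^sup>2 * (\<Sum>j=1..<n. eta j + zeta (T n))"
      using elim by (intro \<phi>_\<gamma>_diff) (auto simp: T_def)
    also have "(T n)\<^sup>2 * (\<Sum>j=1..<n. eta j + zeta (T n)) \<le> s\<^sup>2 * ((\<Sum>j=1..<n. eta j) / n) + s\<^sup>2 * \<bar>zeta (T n)\<bar>"
    proof -
      have "(\<Sum>j=1..<n. eta j + zeta (T n)) = (\<Sum>j=1..<n. eta j) + (real n - 1) * zeta (T n)"
        using elim by (simp add: sum.distrib of_nat_diff)
      also have "\<dots> \<le> (\<Sum>j=1..<n. eta j) + n * \<bar>zeta (T n)\<bar>"
        using elim mult_left_mono[OF abs_ge_self, of "real n - 1" "zeta (T n)"]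
          mult_right_mono[of "real n - 1" n "\<bar>zeta (T n)\<bar>"] by simp
      finally have "(T n)\<^sup>2 * (\<Sum>j=1..<n. eta j + zeta (T n)) \<le>
          s\<^sup>2 / n * ((\<Sum>j=1..<n. eta j) + n * \<bar>zeta (T n)\<bar>)"
        unfolding Tn by (intro mult_left_mono) auto
      also have "\<dots> = s\<^sup>2 * ((\<Sum>j=1..<n. eta j) / n) + s\<^sup>2 * \<bar>zeta (T n)\<bar>"
        using elim by (simp add: field_simps)
      finally show ?thesis .
    qed
    finally show ?case by (simp add: \<gamma> b_def)
  qed
  then have "(\<lambda>n. \<phi> n (s / sqrt n) - of_real (exp (- (s\<^sup>2 * tau) / 2))) \<longlonglongrightarrow> 0"
    by (rule Lim_null_comparison[OF _ b_lim])
  then show ?thesis by (simp only: LIM_zero_iff)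
qed

lemma cb_walk_CLT:
  "weak_conv_m
    (\<lambda>n. distr M borel (\<lambda>\<omega>. (cb_walk X eps v n \<omega> - p / (2 - p) * m1 * real n) / sqrt (real n)))
    (gaussian 0 tau)"
proof (rule levy_continuity)
  have eq: "(cb_walk X eps v n \<omega> - p / (2 - p) * m1 * real n) / sqrt (real n) = Y n \<omega> / sqrt n" for n \<omega>
    by (simp add: cb_walk_def Y_def sum_subtractf c_def mult.commute)
  show "real_distribution (distr M borel (\<lambda>\<omega>. (cb_walk X eps v n \<omega> - p / (2 - p) * m1 * real n) / sqrt (real n)))" for n
    unfolding eq by (rule real_distribution_distr) measurable
  show "real_distribution (gaussian 0 tau)"
    by (rule gaussian_real_distribution[OF tau_nonneg])
  have "char (distr M borel (\<lambda>\<omega>. Y n \<omega> / sqrt n)) s = \<phi> n (s / sqrt n)" for n s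
    unfolding char_def \<phi>_def by (subst integral_distr) (auto simp: mult.commute)
  then show "(\<lambda>n. char (distr M borel (\<lambda>\<omega>. (cb_walk X eps v n \<omega> - p / (2 - p) * m1 * real n) / sqrt (real n))) s)
      \<longlonglongrightarrow> char (gaussian 0 tau) s" for s
    unfolding eq using \<phi>_scaled_tendsto[of s] by (simp only: char_gaussian[OF tau_nonneg])
qed

end

theorem theorem1p2:
  fixes M :: "'a measure" and \<mu> :: "real measure" and p m1 m2 :: real
    and X :: "nat \<Rightarrow> 'a \<Rightarrow> real" and eps v :: "nat \<Rightarrow> 'a \<Rightarrow> nat"
  assumes "counterbalanced M \<mu> p X eps v"
    and "p \<in> {0<..1}"
    and "integrable M (\<lambda>\<omega>. (X 1 \<omega>)\<^sup>2)"
    and "m1 = prob_space.expectation M (X 1)"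
    and "m2 = prob_space.expectation M (\<lambda>\<omega>. (X 1 \<omega>)\<^sup>2)"
  shows "weak_conv_m
    (\<lambda>n. distr M borel (\<lambda>\<omega>. (cb_walk X eps v n \<omega> - p / (2 - p) * m1 * real n) / sqrt (real n)))
    (gaussian 0 ((m2 - (p / (2 - p) * m1)\<^sup>2) / (3 - 2 * p)))"
proof -
  interpret counterbalanced M \<mu> p X eps v by fact
  interpret L2: counterbalanced_L2 M \<mu> p X eps v
    by unfold_locales (use assms in auto)
  show ?thesis
    using L2.cb_walk_CLT
    unfolding L2.tau_def L2.sg2_def L2.c_def L2.m1_def L2.m2_def assms(4,5) .
qed

end
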